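(* Let $G$ be a finite simple graph on the vertices $x_1,\dots,x_n$, let $\Bbbk$ be a field, and let $I(G)^{\vee}\subset \Bbbk[x_1,\dots,x_n]$ be the vertex cover ideal of $G$. If $G$ is $(C_4,2K_2)$-free and has at least one edge, then $(I(G)^{\vee})^s$ has linear quotients for every $s\geq 1$.
   Context: All graphs are finite and simple. $C_4$ denotes the cycle on 4 vertices, and $2K_2$ denotes its complement graph (two disjoint edges). A graph is $(C_4,2K_2)$-free if it has no induced subgraph isomorphic to $C_4$ and no induced subgraph isomorphic to $2K_2$. A set $C$ of vertices of $G$ is a vertex cover if every edge of $G$ contains a vertex of $C$; it is minimal if no proper subset of $C$ is a vertex cover. The vertex cover ideal of $G$ is $I(G)^{\vee}=(x_{i_1}\cdots x_{i_k} : \{x_{i_1},\dots,x_{i_k}\}\text{ is a minimal vertex cover of }G)\subset\Bbbk[x_1,\dots,x_n]$. A monomial ideal $I\subset\Bbbk[x_1,\dots,x_n]$ has linear quotients if there is an ordering $m_1,\dots,m_q$ of the minimal monomial generators of $I$ such that for every $i=2,\dots,q$ the colon ideal $(m_1,\dots,m_{i-1}):m_i$ is generated by a subset of $\{x_1,\dots,x_n\}$. *)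

theory Defs
  imports Complex_Main "HOL-Library.Poly_Mapping"
begin

section \<open>Finite simple graphs\<close>

type_synonym 'v graph = "'v set \<times> 'v set set"

abbreviation verts :: "'v graph \<Rightarrow> 'v set" where "verts \<equiv> fst"
abbreviation edges :: "'v graph \<Rightarrow> 'v set set" where "edges \<equiv> snd"

definition all_pairs :: "'v set \<Rightarrow> 'v set set" where
  "all_pairs V = {{u, v} | u v. u \<in> V \<and> v \<in> V \<and> u \<noteq> v}"

definition simple_graph :: "'v graph \<Rightarrow> bool" where
  "simple_graph G \<longleftrightarrow> finite (verts G) \<and> edges G \<subseteq> all_pairs (verts G)"

definition complement_graph :: "'v graph \<Rightarrow> 'v graph" where
  "complement_graph G = (verts G, all_pairs (verts G) - edges G)"

definition induced_subgraph :: "'v graph \<Rightarrow> 'v set \<Rightarrow> 'v graph" where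
  "induced_subgraph G W = (W, {e \<in> edges G. e \<subseteq> W})"

definition graph_isomorphic :: "'v graph \<Rightarrow> 'w graph \<Rightarrow> bool" where
  "graph_isomorphic G H \<longleftrightarrow>
     (\<exists>f. bij_betw f (verts G) (verts H) \<and>
          (\<forall>u\<in>verts G. \<forall>v\<in>verts G. {u, v} \<in> edges G \<longleftrightarrow> {f u, f v} \<in> edges H))"

definition induced_free :: "'w graph \<Rightarrow> 'v graph \<Rightarrow> bool" where
  "induced_free H G \<longleftrightarrow>
     \<not> (\<exists>W\<subseteq>verts G. graph_isomorphic (induced_subgraph G W) H)"

definition C4 :: "nat graph" where
  "C4 = ({0, 1, 2, 3}, {{0, 1}, {1, 2}, {2, 3}, {3, 0}})"

definition two_K2 :: "nat graph" where
  "two_K2 = ({0, 1, 2, 3}, {{0, 2}, {1, 3}})"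

lemma two_K2_eq_complement_C4: "two_K2 = complement_graph C4"
proof -
  have "all_pairs {0, 1, 2, 3::nat} = {{0, 1}, {1, 2}, {2, 3}, {3, 0}, {0, 2}, {1, 3}}"
    (is "?L = ?R")
  proof
    show "?L \<subseteq> ?R"
    proof
      fix e assume "e \<in> ?L"
      then obtain u v where "e = {u, v}" "u \<in> {0, 1, 2, 3}" "v \<in> {0, 1, 2, 3}" "u \<noteq> v"
        unfolding all_pairs_def by blast
      then show "e \<in> ?R"
        by (elim insertE emptyE) (simp_all add: insert_commute)
    qed
    have pair: "{a, b} \<in> ?L" if "a \<in> {0, 1, 2, 3}" "b \<in> {0, 1, 2, 3}" "a \<noteq> b" for a b :: nat
      using that unfolding all_pairs_def by blast
    show "?R \<subseteq> ?L"
      unfolding insert_subset by (intro conjI pair empty_subsetI) simp_all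
  qed
  then show ?thesis
    by (simp add: two_K2_def complement_graph_def C4_def doubleton_eq_iff insert_Diff_if)
qed

definition vertex_cover :: "'v graph \<Rightarrow> 'v set \<Rightarrow> bool" where
  "vertex_cover G C \<longleftrightarrow> C \<subseteq> verts G \<and> (\<forall>e\<in>edges G. e \<inter> C \<noteq> {})"

definition minimal_vertex_cover :: "'v graph \<Rightarrow> 'v set \<Rightarrow> bool" where
  "minimal_vertex_cover G C \<longleftrightarrow> vertex_cover G C \<and> (\<forall>D. D \<subset> C \<longrightarrow> \<not> vertex_cover G D)"


section \<open>Ideals of a commutative ring\<close>

text \<open>Ideals are the submodules of the ring regarded as a module over itself.\<close>

lemma module_mult: "module ((*) :: 'a::comm_ring_1 \<Rightarrow> 'a \<Rightarrow> 'a)"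
  by unfold_locales (simp_all add: algebra_simps)

definition ideal_gen :: "'a::comm_ring_1 set \<Rightarrow> 'a set" where
  "ideal_gen S = module.span (*) S"

definition ideal_prod :: "'a::comm_ring_1 set \<Rightarrow> 'a set \<Rightarrow> 'a set" where
  "ideal_prod I J = ideal_gen {a * b | a b. a \<in> I \<and> b \<in> J}"

primrec ideal_power :: "'a::comm_ring_1 set \<Rightarrow> nat \<Rightarrow> 'a set" where
  "ideal_power I 0 = UNIV"
| "ideal_power I (Suc s) = ideal_prod I (ideal_power I s)"

definition ideal_colon :: "'a::comm_ring_1 set \<Rightarrow> 'a \<Rightarrow> 'a set" where
  "ideal_colon I f = {g. g * f \<in> I}"


section \<open>Monomial ideals of a polynomial ring\<close>

text \<open>
  For a finite type \<open>'v\<close>, the type below is the polynomial ring over \<open>'k\<close> with one variable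
  for each element of \<open>'v\<close>: finitely supported maps from exponent vectors to coefficients, with
  the convolution product of \<open>Poly_Mapping\<close>.
\<close>

type_synonym ('v, 'k) mpoly = "('v \<Rightarrow>\<^sub>0 nat) \<Rightarrow>\<^sub>0 'k"

definition monomial :: "('v \<Rightarrow>\<^sub>0 nat) \<Rightarrow> ('v, 'k::comm_ring_1) mpoly" where
  "monomial e = Poly_Mapping.single e 1"

definition var :: "'v \<Rightarrow> ('v, 'k::comm_ring_1) mpoly" where
  "var v = monomial (Poly_Mapping.single v 1)"

definition minimal_monomial_generators ::
    "('v, 'k::comm_ring_1) mpoly set \<Rightarrow> ('v, 'k) mpoly set \<Rightarrow> bool" where
  "minimal_monomial_generators I M \<longleftrightarrow>
     M \<subseteq> range monomial \<and> ideal_gen M = I \<and> (\<forall>N. N \<subset> M \<longrightarrow> ideal_gen N \<noteq> I)"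

text \<open>
  A monomial ideal has exactly one minimal set of monomial generators, so quantifying over
  enumerations \<open>ms\<close> of such a set is the same as quantifying over the orderings of that set.
  The list is indexed from \<open>0\<close>, so \<open>ms ! i\<close> is the generator with \<open>i\<close> predecessors
  \<open>take i ms\<close>.
\<close>

definition linear_quotients :: "('v, 'k::comm_ring_1) mpoly set \<Rightarrow> bool" where
  "linear_quotients I \<longleftrightarrow>
     (\<exists>ms. distinct ms \<and> minimal_monomial_generators I (set ms) \<and>
           (\<forall>i. 1 \<le> i \<and> i < length ms \<longrightarrow>
              (\<exists>X\<subseteq>range var.
                 ideal_colon (ideal_gen (set (take i ms))) (ms ! i) = ideal_gen X)))"

definition vertex_cover_ideal :: "'v graph \<Rightarrow> ('v, 'k::comm_ring_1) mpoly set" where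
  "vertex_cover_ideal G = ideal_gen {(\<Prod>v\<in>C. var v) | C. minimal_vertex_cover G C}"

end

theory Submission
  imports Defs "HOL-Library.Product_Lexorder"
begin

text \<open>
  A \<open>(C\<^sub>4, 2K\<^sub>2)\<close>-free graph is pseudo-split: its vertices are the union of a clique \<open>K\<close>, an
  independent set \<open>S\<close>, and possibly a pentagon all of whose vertices are adjacent to all of \<open>K\<close> and
  to none of \<open>S\<close>. The minimal vertex covers are then the neighbourhoods \<open>N(k)\<close> with \<open>k \<in> K\<close> and the
  sets \<open>K \<union> F\<close>, where \<open>F\<close> is empty or one of the five minimal covers of the pentagon. Distinct
  multisets of \<open>s\<close> covers give monomials that do not divide each other. These are ordered by the number
  of factors \<open>N(k)\<close>, and then by a lexicographic order on the multiplicities of the covers of the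
  pentagon. Replacing \<open>N(k)\<close> by \<open>K \<union> F\<close> raises only the exponent of \<open>k\<close>; together with a few
  exchanges among the covers of the pentagon, this shows that every colon ideal is generated by
  variables.
\<close>

section \<open>Pseudo-split graphs\<close>

abbreviation adj :: "'v graph \<Rightarrow> 'v \<Rightarrow> 'v \<Rightarrow> bool" where
  "adj G u v \<equiv> {u, v} \<in> edges G"

lemma adj_sym: "adj G u v \<longleftrightarrow> adj G v u"
  by (simp add: insert_commute)

lemma adj_irrefl: "simple_graph G \<Longrightarrow> \<not> adj G u u"
  by (auto simp: simple_graph_def all_pairs_def doubleton_eq_iff)

section \<open>Forbidden induced subgraphs as statements about adjacency\<close>

lemma induced_free_C4D:
  assumes "simple_graph G" "verts G = UNIV" "induced_free C4 G"
    and "adj G a b" "adj G b c" "adj G c d" "adj G d a" "\<not> adj G a c" "\<not> adj G b d" "a \<noteq> c" "b \<noteq> d"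
  shows False
proof -
  have dist: "a \<noteq> b" "b \<noteq> c" "c \<noteq> d" "d \<noteq> a"
    using assms adj_irrefl[OF assms(1)] by auto
  \<comment> \<open>Places \<open>a\<close>, \<open>b\<close>, \<open>c\<close>, \<open>d\<close> in
    cyclic order on \<open>C4\<close>; the default 3 is the value at \<open>d\<close>.\<close>
  define f where "f = (\<lambda>x. if x = a then 0 else if x = b then 1 else if x = c then 2 else (3::nat))"
  have f: "f a = 0" "f b = 1" "f c = 2" "f d = 3"
    using dist assms(10,11) by (auto simp: f_def)
  have "bij_betw f {a, b, c, d} {0, 1, 2, 3}"
    by (auto simp: bij_betw_def inj_on_def f)
  moreover have "{u, v} \<in> edges (induced_subgraph G {a, b, c, d}) \<longleftrightarrow> {f u, f v} \<in> edges C4"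
    if "u \<in> {a, b, c, d}" "v \<in> {a, b, c, d}" for u v
    using that assms(4-9) adj_irrefl[OF assms(1)]
    by (elim insertE emptyE) (simp_all add: induced_subgraph_def C4_def f doubleton_eq_iff insert_commute)
  ultimately have "graph_isomorphic (induced_subgraph G {a, b, c, d}) C4"
    by (auto simp: graph_isomorphic_def induced_subgraph_def C4_def)
  then show False
    using assms(2,3) by (auto simp: induced_free_def)
qed

lemma induced_free_two_K2D:
  assumes "simple_graph G" "verts G = UNIV" "induced_free two_K2 G"
    and "adj G a b" "adj G c d" "\<not> adj G a c" "\<not> adj G a d" "\<not> adj G b c" "\<not> adj G b d"
  shows False
proof -
  have dist: "a \<noteq> b" "c \<noteq> d" "a \<noteq> c" "a \<noteq> d" "b \<noteq> c" "b \<noteq> d"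
    using assms(4-9) adj_irrefl[OF assms(1)] by (auto simp: insert_commute)
  \<comment> \<open>The edges of \<open>two_K2\<close> are 0-2 and 1-3, so the partner
    \<open>b\<close> of \<open>a\<close> goes to 2 and \<open>c\<close> to 1.\<close>
  define f where "f = (\<lambda>x. if x = a then 0 else if x = c then 1 else if x = b then 2 else (3::nat))"
  have f: "f a = 0" "f b = 2" "f c = 1" "f d = 3"
    using dist by (auto simp: f_def)
  have "bij_betw f {a, b, c, d} {0, 1, 2, 3}"
    by (auto simp: bij_betw_def inj_on_def f)
  moreover have "{u, v} \<in> edges (induced_subgraph G {a, b, c, d}) \<longleftrightarrow> {f u, f v} \<in> edges two_K2"
    if "u \<in> {a, b, c, d}" "v \<in> {a, b, c, d}" for u v
    using that assms(4-9) adj_irrefl[OF assms(1)]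
    by (elim insertE emptyE)
      (simp_all add: induced_subgraph_def two_K2_def f doubleton_eq_iff insert_commute)
  ultimately have "graph_isomorphic (induced_subgraph G {a, b, c, d}) two_K2"
    by (auto simp: graph_isomorphic_def induced_subgraph_def two_K2_def)
  then show False
    using assms(2,3) by (auto simp: induced_free_def)
qed

lemma finite_ex_max:
  fixes f :: "'a \<Rightarrow> nat"
  assumes "finite A" "A \<noteq> {}"
  shows "\<exists>x\<in>A. \<forall>y\<in>A. f y \<le> f x"
proof -
  have "Max (f ` A) \<in> f ` A" using assms by (intro Max_in) auto
  then obtain x where "x \<in> A" "f x = Max (f ` A)" by auto
  moreover have "f y \<le> Max (f ` A)" if "y \<in> A" for y
    using assms(1) that by simp
  ultimately show ?thesis by metis
qed

section \<open>The Foldes-Hammer theorem on split graphs, and the vertices around a pentagon\<close>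

definition clique :: "('v \<Rightarrow> 'v \<Rightarrow> bool) \<Rightarrow> 'v set \<Rightarrow> bool" where
  "clique E K \<longleftrightarrow> (\<forall>x\<in>K. \<forall>y\<in>K. x \<noteq> y \<longrightarrow> E x y)"

definition independent_set :: "('v \<Rightarrow> 'v \<Rightarrow> bool) \<Rightarrow> 'v set \<Rightarrow> bool" where
  "independent_set E S \<longleftrightarrow> (\<forall>x\<in>S. \<forall>y\<in>S. \<not> E x y)"

text \<open>For a symmetric irreflexive \<open>E\<close> the listed adjacencies and non-adjacencies
  already force the five vertices to be distinct.\<close>

definition induced_C5 :: "('v \<Rightarrow> 'v \<Rightarrow> bool) \<Rightarrow> 'v \<Rightarrow> 'v \<Rightarrow> 'v \<Rightarrow> 'v \<Rightarrow> 'v \<Rightarrow> bool" where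
  "induced_C5 E a b c d e \<longleftrightarrow> E a b \<and> E b c \<and> E c d \<and> E d e \<and> E e a \<and>
    \<not> E a c \<and> \<not> E b d \<and> \<not> E c e \<and> \<not> E d a \<and> \<not> E e b"

text \<open>Distinctness is assumed only for opposite vertices of the four-cycle: adjacent ones
  differ by \<open>irrefl\<close>, and in \<open>no_2K2\<close> a vertex common to both edges would
  create one of the excluded adjacencies.\<close>

locale C4_2K2_free =
  fixes E :: "'v::finite \<Rightarrow> 'v \<Rightarrow> bool"
  assumes sym: "\<And>x y. E x y \<longleftrightarrow> E y x"
    and irrefl: "\<And>x. \<not> E x x"
    and no_C4: "\<And>a b c d. E a b \<Longrightarrow> E b c \<Longrightarrow> E c d \<Longrightarrow> E d a \<Longrightarrow> \<not> E a c \<Longrightarrow> \<not> E b d \<Longrightarrow>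
      a \<noteq> c \<Longrightarrow> b \<noteq> d \<Longrightarrow> False"
    and no_2K2: "\<And>a b c d. E a b \<Longrightarrow> E c d \<Longrightarrow> \<not> E a c \<Longrightarrow> \<not> E a d \<Longrightarrow> \<not> E b c \<Longrightarrow> \<not> E b d \<Longrightarrow> False"
begin

lemma ex_clique_independent_complement:
  assumes no_C5: "\<And>a b c d e. \<not> induced_C5 E a b c d e"
  shows "\<exists>K. clique E K \<and> independent_set E (- K)"
proof -
  \<comment> \<open>Among the maximum cliques, one of maximal degree sum has an independent complement.\<close>
  define deg where "deg x = card {y. E x y}" for x
  obtain K0 where K0: "clique E K0" "\<And>K. clique E K \<Longrightarrow> card K \<le> card K0"
    using finite_ex_max[of "{K. clique E K}" card] by (auto simp: clique_def)
  obtain K where K: "clique E K" "card K = card K0"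
    "\<And>L. clique E L \<Longrightarrow> card L = card K0 \<Longrightarrow> sum deg L \<le> sum deg K"
    using finite_ex_max[of "{K. clique E K \<and> card K = card K0}" "sum deg"] K0(1) by auto
  have max: "card L \<le> card K" if "clique E L" for L
    using K0(2)[OF that] K(2) by simp
  have nonadj: "\<exists>u\<in>K. \<not> E x u" if "x \<notin> K" for x
  proof (rule ccontr)
    assume "\<not> ?thesis"
    then have "clique E (insert x K)"
      using K(1) sym unfolding clique_def by blast
    from max[OF this] that show False by simp
  qed
  \<comment> \<open>Here \<open>u\<close> is the only vertex of \<open>K\<close> that
    \<open>x\<close> misses, so \<open>x\<close> can replace \<open>u\<close> in a maximum clique.
    Comparing degree sums yields a neighbour \<open>z\<close> of \<open>u\<close> that is not
    adjacent to \<open>x\<close>. It then turns out that \<open>u\<close> can be replaced by both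
    \<open>y\<close> and \<open>z\<close>, which gives a clique larger than
    \<open>K\<close>.\<close>
  have key: False
    if xy: "x \<notin> K" "y \<notin> K" "E x y" and u: "u \<in> K" "\<not> E x u" "\<not> E y u"
      and all: "\<And>v. v \<in> K \<Longrightarrow> v \<noteq> u \<Longrightarrow> E x v" for x y u
  proof -
    let ?L = "insert x (K - {u})"
    have "clique E ?L"
      using K(1) all sym unfolding clique_def by blast
    moreover have "card ?L = card K0"
      using xy u K(2) card_Suc_Diff1[of K u] by simp
    ultimately have "sum deg ?L \<le> sum deg K" by (rule K(3))
    then have "deg x \<le> deg u"
      using xy u by (simp add: sum.remove[of K u])
    moreover have "deg u < deg x" if "{z. E u z} \<subseteq> {z. E x z}"
    proof -
      \<comment> \<open>Strict because \<open>y\<close> is a neighbour of \<open>x\<close> but not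
        of \<open>u\<close>.\<close>
      have "{z. E u z} \<subset> {z. E x z}" using that xy u sym by blast
      then show ?thesis unfolding deg_def by (simp add: psubset_card_mono)
    qed
    ultimately obtain z where z: "E u z" "\<not> E x z" by fastforce
    have ne: "z \<noteq> x" "z \<noteq> y" "z \<notin> K" "u \<noteq> y"
      using z u xy sym irrefl all by blast+
    have yz: "E y z"
      using no_2K2[of x y u z] xy u z by blast
    have both: "E w y \<and> E w z" if w: "w \<in> K" "w \<noteq> u" for w
    proof -
      have wx: "E w x" "E w u" using all w sym K(1) u(1) unfolding clique_def by blast+
      have "w \<noteq> y" "w \<noteq> z" using w xy ne by blast+
      \<comment> \<open>If \<open>w\<close> missed both, \<open>x y z u w\<close> would be an
        induced pentagon; if it met only one, there would be an induced four-cycle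
        \<open>w y z u\<close> or \<open>x y z w\<close>.\<close>
      have "E w y \<or> E w z"
        using no_C5[of x y z u w] xy yz z u wx sym unfolding induced_C5_def by blast
      moreover have "E w y \<Longrightarrow> E w z"
        using no_C4[of w y z u] yz z wx u sym ne \<open>w \<noteq> z\<close> by blast
      moreover have "E w z \<Longrightarrow> E w y"
        using no_C4[of x y z w] xy yz z wx sym ne \<open>w \<noteq> y\<close> by blast
      ultimately show ?thesis by blast
    qed
    have "clique E (insert y (insert z (K - {u})))"
      using K(1) both yz sym unfolding clique_def by blast
    from max[OF this] show False
      using xy ne u card_Suc_Diff1[of K u] by simp
  qed
  have "\<not> E x y" if xy: "x \<notin> K" "y \<notin> K" for x y
  proof
    assume E: "E x y"
    \<comment> \<open>The sets of non-neighbours in \<open>K\<close> are nested, since otherwise a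
      four-cycle \<open>x y a b\<close> appears, and they share at most one vertex, since two would
      span an edge forming a 2K_2 with \<open>x y\<close>. So the smaller set is a singleton, as
      \<open>key\<close> requires.\<close>
    define N where "N v = {w \<in> K. \<not> E v w}" for v
    have uniq: "a = b" if "a \<in> N x" "a \<in> N y" "b \<in> N x" "b \<in> N y" for a b
      using that no_2K2[OF E, of a b] K(1) unfolding N_def clique_def by blast
    have "N x \<subseteq> N y \<or> N y \<subseteq> N x"
    proof (rule ccontr)
      assume "\<not> ?thesis"
      then obtain a b where "a \<in> K" "\<not> E x a" "E y a" "b \<in> K" "\<not> E y b" "E x b"
        by (auto simp: N_def)
      then show False
        using no_C4[of x y a b] E xy K(1) sym unfolding clique_def by metis
    qed
    then show False
    proof
      assume sub: "N x \<subseteq> N y"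
      obtain u where "u \<in> N x" using nonadj[OF xy(1)] by (auto simp: N_def)
      then show False
        using key[OF xy E, of u] sub uniq by (auto simp: N_def)
    next
      assume sub: "N y \<subseteq> N x"
      obtain u where "u \<in> N y" using nonadj[OF xy(2)] by (auto simp: N_def)
      then show False
        using key[OF xy(2,1) sym[THEN iffD1, OF E], of u] sub uniq by (auto simp: N_def)
    qed
  qed
  then show ?thesis using K(1) by (auto simp: independent_set_def)
qed

text \<open>The extra condition makes \<open>K\<close> itself a minimal cover. A vertex
  \<open>k\<close> of the clique with no neighbour outside can be moved to the independent side; one
  such move is enough, because \<open>k\<close> is then an outside neighbour of every remaining
  clique vertex.\<close>

lemma ex_split_partition:
  assumes "\<And>a b c d e. \<not> induced_C5 E a b c d e"
  shows "\<exists>K. clique E K \<and> independent_set E (- K) \<and> (\<forall>k\<in>K. \<exists>v. v \<notin> K \<and> E k v)"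
proof -
  obtain K where K: "clique E K" "independent_set E (- K)"
    using ex_clique_independent_complement[OF assms] by blast
  show ?thesis
  proof (cases "\<forall>k\<in>K. \<exists>v. v \<notin> K \<and> E k v")
    case False
    then obtain k where k: "k \<in> K" "\<And>v. v \<notin> K \<Longrightarrow> \<not> E k v" by blast
    have "clique E (K - {k})" using K(1) by (simp add: clique_def)
    moreover have "independent_set E (- (K - {k}))"
      using K(2) k sym irrefl unfolding independent_set_def by blast
    moreover have "\<forall>k'\<in>K - {k}. \<exists>v. v \<notin> K - {k} \<and> E k' v"
      using K(1) k(1) unfolding clique_def by blast
    ultimately show ?thesis by blast
  qed (use K in blast)
qed

text \<open>Two neighbours of \<open>v\<close> at distance two on the pentagon force the vertex
  between them (\<open>mid\<close>, no C_4), and one neighbour forces an end of the opposite edge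
  (\<open>opp\<close>, no 2K_2). By these two rules a single neighbour spreads to all five.\<close>

lemma induced_C5_all_or_none:
  assumes C5: "induced_C5 E a b c d e" and v: "v \<notin> {a, b, c, d, e}"
  shows "(E v a \<and> E v b \<and> E v c \<and> E v d \<and> E v e) \<or>
    (\<not> E v a \<and> \<not> E v b \<and> \<not> E v c \<and> \<not> E v d \<and> \<not> E v e)"
proof -
  have mid: "E v y" if "E v x" "E v z" "E x y" "E y z" "\<not> E x z" "x \<noteq> z" "v \<noteq> y" for x y z
    using no_C4[of v x y z] that sym by blast
  have opp: "E v y \<or> E v z" if "E v x" "E y z" "\<not> E x y" "\<not> E x z" for x y z
    using no_2K2[of v x y z] that by blast
  have C: "E a b" "E b c" "E c d" "E d e" "E e a" "\<not> E a c" "\<not> E b d" "\<not> E c e" "\<not> E d a" "\<not> E e b"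
    using C5 by (simp_all add: induced_C5_def)
  have ne: "a \<noteq> c" "b \<noteq> d" "c \<noteq> e" "d \<noteq> a" "e \<noteq> b"
    using C sym by blast+
  have "E v a \<and> E v c \<longrightarrow> E v b" "E v b \<and> E v d \<longrightarrow> E v c" "E v c \<and> E v e \<longrightarrow> E v d"
    "E v d \<and> E v a \<longrightarrow> E v e" "E v e \<and> E v b \<longrightarrow> E v a"
    using mid[of a c b] mid[of b d c] mid[of c e d] mid[of d a e] mid[of e b a] C ne v
    unfolding insert_iff empty_iff by blast+
  moreover have "E v a \<longrightarrow> E v c \<or> E v d" "E v b \<longrightarrow> E v d \<or> E v e" "E v c \<longrightarrow> E v e \<or> E v a"
    "E v d \<longrightarrow> E v a \<or> E v b" "E v e \<longrightarrow> E v b \<or> E v c"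
    using opp[of a c d] opp[of b d e] opp[of c e a] opp[of d a b] opp[of e b c] C
      sym[of a d] sym[of b e] sym[of c a] sym[of d b] sym[of e c] by blast+
  ultimately show ?thesis by argo
qed

end

abbreviation lookup :: "('a \<Rightarrow>\<^sub>0 'b::zero) \<Rightarrow> 'a \<Rightarrow> 'b" where
  "lookup \<equiv> poly_mapping.lookup"

abbreviation keys :: "('a \<Rightarrow>\<^sub>0 'b::zero) \<Rightarrow> 'a set" where
  "keys \<equiv> Poly_Mapping.keys"

section \<open>Generators of ideals\<close>

lemma ideal_gen_base: "x \<in> S \<Longrightarrow> x \<in> ideal_gen S"
  unfolding ideal_gen_def by (rule module.span_base[OF module_mult])

lemma ideal_gen_zero: "0 \<in> ideal_gen S"
  unfolding ideal_gen_def by (rule module.span_zero[OF module_mult])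

lemma ideal_gen_add: "x \<in> ideal_gen S \<Longrightarrow> y \<in> ideal_gen S \<Longrightarrow> x + y \<in> ideal_gen S"
  unfolding ideal_gen_def by (rule module.span_add[OF module_mult])

lemma ideal_gen_mult: "x \<in> ideal_gen S \<Longrightarrow> r * x \<in> ideal_gen S"
  unfolding ideal_gen_def by (rule module.span_scale[OF module_mult])

lemma ideal_gen_sum: "(\<And>i. i \<in> I \<Longrightarrow> f i \<in> ideal_gen S) \<Longrightarrow> sum f I \<in> ideal_gen S"
  unfolding ideal_gen_def by (rule module.span_sum[OF module_mult])

lemma ideal_gen_induct [consumes 1, case_names zero add mult base]:
  assumes "x \<in> ideal_gen S" and "P 0" and "\<And>x y. P x \<Longrightarrow> P y \<Longrightarrow> P (x + y)"
    and "\<And>r x. P x \<Longrightarrow> P (r * x)" and "\<And>x. x \<in> S \<Longrightarrow> P x"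
  shows "P x"
proof -
  have "module.subspace (*) (Collect P)"
    using assms(2-4) by (simp add: module.subspace_def[OF module_mult])
  then have "module.span (*) S \<subseteq> Collect P"
    by (rule module.span_minimal[OF module_mult, rotated]) (use assms(5) in blast)
  then show ?thesis using assms(1) unfolding ideal_gen_def by blast
qed

lemma ideal_gen_mono:
  assumes "S \<subseteq> ideal_gen T"
  shows "ideal_gen S \<subseteq> ideal_gen T"
proof
  fix x assume "x \<in> ideal_gen S"
  then show "x \<in> ideal_gen T"
    by (induction rule: ideal_gen_induct)
      (use assms in \<open>auto intro: ideal_gen_zero ideal_gen_add ideal_gen_mult\<close>)
qed

lemma ideal_gen_mult_mem:
  assumes "x \<in> ideal_gen A" and "\<And>a. a \<in> A \<Longrightarrow> a * b \<in> ideal_gen P"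
  shows "x * b \<in> ideal_gen P"
  using assms(1)
  by (induction rule: ideal_gen_induct)
    (simp_all add: distrib_right mult.assoc ideal_gen_zero ideal_gen_add ideal_gen_mult assms(2))

text \<open>Bilinearity is used one factor at a time: first the second factor varies with a
  generator of the first held fixed, then the first factor varies.\<close>

lemma ideal_prod_ideal_gen:
  "ideal_prod (ideal_gen A) (ideal_gen B) = ideal_gen {a * b | a b. a \<in> A \<and> b \<in> B}"
    (is "_ = ideal_gen ?P")
proof
  show "ideal_gen ?P \<subseteq> ideal_prod (ideal_gen A) (ideal_gen B)"
    unfolding ideal_prod_def by (rule ideal_gen_mono) (blast intro: ideal_gen_base)
  have "b * a \<in> ideal_gen ?P" if "a \<in> A" "b \<in> B" for a b
    using that by (subst mult.commute) (blast intro: ideal_gen_base)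
  then have "y * a \<in> ideal_gen ?P" if "a \<in> A" "y \<in> ideal_gen B" for a y
    using that ideal_gen_mult_mem by blast
  then have "a * y \<in> ideal_gen ?P" if "a \<in> A" "y \<in> ideal_gen B" for a y
    using that by (subst mult.commute)
  then have "x * y \<in> ideal_gen ?P" if "x \<in> ideal_gen A" "y \<in> ideal_gen B" for x y
    using that ideal_gen_mult_mem by blast
  then show "ideal_prod (ideal_gen A) (ideal_gen B) \<subseteq> ideal_gen ?P"
    unfolding ideal_prod_def by (intro ideal_gen_mono) blast
qed

section \<open>Monomial ideals\<close>

lemma monomial_add: "monomial (a + b) = monomial a * monomial b"
  by (simp add: monomial_def mult_single)

lemma inj_monomial: "inj (monomial :: _ \<Rightarrow> ('v, 'k::field) mpoly)"
  by (rule injI) (metis keys_single monomial_def one_neq_zero the_elem_eq)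

lemma lookup_le_imp_diff_add:
  fixes e t :: "'v \<Rightarrow>\<^sub>0 nat"
  assumes "lookup e \<le> lookup t"
  shows "t - e + e = t"
  using assms by (intro poly_mapping_eqI) (simp add: lookup_add lookup_minus le_fun_def)

lemma poly_mapping_sum_single:
  fixes p :: "'a \<Rightarrow>\<^sub>0 'b::comm_monoid_add"
  shows "p = (\<Sum>t\<in>keys p. Poly_Mapping.single t (lookup p t))"
proof (rule poly_mapping_eqI)
  fix k
  have "(\<Sum>t\<in>keys p. lookup (Poly_Mapping.single t (lookup p t)) k) =
        (\<Sum>t\<in>keys p. if t = k then lookup p k else 0)"
    by (intro sum.cong) (auto simp: lookup_single when_def)
  then show "lookup p k = lookup (\<Sum>t\<in>keys p. Poly_Mapping.single t (lookup p t)) k"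
    by (simp add: lookup_sum in_keys_iff)
qed

text \<open>The shift of exponents by \<open>m\<close> is injective, so no terms cancel. This turns
  a colon by a monomial into a condition on exponents.\<close>

lemma keys_mult_monomial:
  fixes p :: "('v, 'k::comm_ring_1) mpoly"
  shows "keys (p * monomial m) = (\<lambda>t. t + m) ` keys p"
proof -
  have eq: "p * monomial m = (\<Sum>t\<in>keys p. Poly_Mapping.single (t + m) (lookup p t))"
    by (subst poly_mapping_sum_single[of p])
      (simp add: monomial_def sum_distrib_right mult_single)
  have look: "lookup (p * monomial m) (t + m) = lookup p t" for t
  proof -
    have "lookup (p * monomial m) (t + m) = (\<Sum>u\<in>keys p. if u = t then lookup p t else 0)"
      unfolding eq lookup_sum by (intro sum.cong) (auto simp: lookup_single when_def)
    then show ?thesis by (simp add: in_keys_iff)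
  qed
  have "keys (p * monomial m) \<subseteq> (\<lambda>t. t + m) ` keys p"
  proof -
    have "keys (p * monomial m) \<subseteq> (\<Union>t\<in>keys p. keys (Poly_Mapping.single (t + m) (lookup p t)))"
      unfolding eq by (rule keys_sum)
    also have "\<dots> \<subseteq> (\<lambda>t. t + m) ` keys p"
      by auto
    finally show ?thesis .
  qed
  then show ?thesis
    by (auto simp: in_keys_iff look)
qed

text \<open>Divisibility of every term by some generator survives sums and multiples; conversely a
  polynomial is the sum of its terms. Questions about monomial ideals thereby become comparisons of
  exponent vectors.\<close>

lemma mem_ideal_gen_monomials:
  fixes p :: "('v, 'k::field) mpoly"
  shows "p \<in> ideal_gen (monomial ` E) \<longleftrightarrow> (\<forall>t\<in>keys p. \<exists>e\<in>E. lookup e \<le> lookup t)"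
proof
  show "\<forall>t\<in>keys p. \<exists>e\<in>E. lookup e \<le> lookup t" if "p \<in> ideal_gen (monomial ` E)"
    using that
  proof (induction rule: ideal_gen_induct)
    case (add x y)
    then show ?case using keys_add[of x y] add by blast
  next
    case (mult c x)
    show ?case
    proof
      fix t assume "t \<in> keys (c * x)"
      then obtain a b where t: "t = a + b" "b \<in> keys x"
        using keys_mult[of c x] by blast
      then obtain e where "e \<in> E" "lookup e \<le> lookup b"
        using mult by blast
      then show "\<exists>e\<in>E. lookup e \<le> lookup t"
        by (intro bexI[of _ e]) (auto simp: t le_fun_def lookup_add intro: trans_le_add2)
    qed
  qed (auto simp: monomial_def)
next
  assume *: "\<forall>t\<in>keys p. \<exists>e\<in>E. lookup e \<le> lookup t"
  have "Poly_Mapping.single t (lookup p t) \<in> ideal_gen (monomial ` E)" if t: "t \<in> keys p" for t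
  proof -
    obtain e where e: "e \<in> E" "lookup e \<le> lookup t"
      using * t by blast
    have "Poly_Mapping.single t (lookup p t) = Poly_Mapping.single (t - e) (lookup p t) * monomial e"
      using lookup_le_imp_diff_add[OF e(2)] by (simp add: monomial_def mult_single)
    then show ?thesis
      using e by (simp add: ideal_gen_base ideal_gen_mult)
  qed
  then have "(\<Sum>t\<in>keys p. Poly_Mapping.single t (lookup p t)) \<in> ideal_gen (monomial ` E)"
    by (rule ideal_gen_sum)
  then show "p \<in> ideal_gen (monomial ` E)"
    by (simp only: poly_mapping_sum_single[of p, symmetric])
qed

lemma monomial_mem_ideal_gen_monomials:
  "(monomial t :: ('v, 'k::field) mpoly) \<in> ideal_gen (monomial ` E) \<longleftrightarrow> (\<exists>e\<in>E. lookup e \<le> lookup t)"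
  by (simp add: mem_ideal_gen_monomials) (simp add: monomial_def)

text \<open>A generator left out is divisible by none of those kept, hence is lost from the
  ideal.\<close>

lemma minimal_monomial_generators_antichain:
  fixes E :: "('v \<Rightarrow>\<^sub>0 nat) set"
  assumes "\<And>a b. a \<in> E \<Longrightarrow> b \<in> E \<Longrightarrow> lookup a \<le> lookup b \<Longrightarrow> a = b"
  shows "minimal_monomial_generators (ideal_gen (monomial ` E))
    (monomial ` E :: ('v, 'k::field) mpoly set)"
  unfolding minimal_monomial_generators_def
proof (intro conjI allI impI)
  fix N :: "('v, 'k) mpoly set" assume N: "N \<subset> monomial ` E"
  then obtain F where F: "F \<subseteq> E" "N = monomial ` F" by (meson psubset_imp_subset subset_image_iff)
  then obtain e where e: "e \<in> E" "e \<notin> F" using N by blast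
  have "(monomial e :: ('v, 'k) mpoly) \<notin> ideal_gen N"
    unfolding F(2) monomial_mem_ideal_gen_monomials using assms e F(1) by blast
  then show "ideal_gen N \<noteq> ideal_gen (monomial ` E)"
    using e(1) by (metis ideal_gen_base imageI)
qed auto

text \<open>The generators are sorted by \<open>key\<close>, with ties in an arbitrary order.
  Therefore \<open>exch\<close> must treat every \<open>a\<close> with
  \<open>key a \<le> key b\<close>, while the \<open>c\<close> it supplies has a strictly smaller
  key and surely precedes \<open>b\<close>. That \<open>c\<close> puts the variable \<open>v\<close>
  into the colon ideal, and \<open>v\<close> divides whatever \<open>a\<close> contributes to
  it.\<close>

lemma linear_quotients_exchange:
  fixes f :: "'a \<Rightarrow> ('v \<Rightarrow>\<^sub>0 nat)" and key :: "'a \<Rightarrow> 'b::linorder"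
  assumes fin: "finite T"
    and anti: "\<And>a b. a \<in> T \<Longrightarrow> b \<in> T \<Longrightarrow> lookup (f a) \<le> lookup (f b) \<Longrightarrow> a = b"
    and exch: "\<And>a b. a \<in> T \<Longrightarrow> b \<in> T \<Longrightarrow> a \<noteq> b \<Longrightarrow> key a \<le> key b \<Longrightarrow>
      \<exists>c\<in>T. \<exists>v. key c < key b \<and> lookup (f b) v < lookup (f a) v \<and>
        lookup (f c) \<le> lookup (f b + Poly_Mapping.single v 1)"
  shows "linear_quotients (ideal_gen (monomial ` f ` T) :: ('v, 'k::field) mpoly set)"
proof -
  define xs where "xs = sort_key key (SOME xs. set xs = T \<and> distinct xs)"
  have "\<exists>xs. set xs = T \<and> distinct xs" using fin by (rule finite_distinct_list)
  from someI_ex[OF this] have xs: "set xs = T" "distinct xs" "sorted (map key xs)"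
    by (simp_all add: xs_def)
  have inj: "inj_on f T" by (rule inj_onI) (simp add: anti)
  define ms :: "('v, 'k) mpoly list" where "ms = map (monomial \<circ> f) xs"
  have "distinct ms"
    unfolding ms_def using inj xs inj_monomial
    by (auto simp: distinct_map intro: comp_inj_on inj_on_subset)
  moreover have "set ms = monomial ` f ` T"
    by (simp add: ms_def xs image_comp)
  moreover have "minimal_monomial_generators (ideal_gen (monomial ` f ` T))
    (monomial ` f ` T :: ('v, 'k) mpoly set)"
    by (rule minimal_monomial_generators_antichain) (use anti in blast)
  moreover have "\<exists>X\<subseteq>range var. ideal_colon (ideal_gen (set (take i ms))) (ms ! i) = ideal_gen X"
    if i: "i < length ms" for i
  proof -
    define P where "P = set (take i xs)"
    define b where "b = xs ! i"
    have len: "i < length xs" using i by (simp add: ms_def)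
    have b: "b \<in> T" "ms ! i = monomial (f b)"
      using len xs by (auto simp: b_def ms_def)
    have take_ms: "set (take i ms) = monomial ` f ` P"
      by (simp add: ms_def P_def take_map image_comp)
    have Pb: "a \<in> T \<and> a \<noteq> b \<and> key a \<le> key b" if a: "a \<in> P" for a
    proof -
      obtain j where j: "j < i" "a = xs ! j"
        using a len by (auto simp: P_def in_set_conv_nth)
      then show ?thesis
        using len xs sorted_nth_mono[OF xs(3), of j i]
        by (auto simp: b_def nth_eq_iff_index_eq)
    qed
    have less_P: "c \<in> P" if c: "c \<in> T" "key c < key b" for c
    proof -
      obtain j where j: "j < length xs" "c = xs ! j"
        using c xs by (metis in_set_conv_nth)
      have "j < i"
        using sorted_nth_mono[OF xs(3), of i j] j c by (force simp: b_def)
      then show ?thesis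
        using j by (auto simp: P_def in_set_conv_nth)
    qed
    \<comment> \<open>The variables that lie in the colon ideal of \<open>b\<close>.\<close>
    define V where "V = {v. \<exists>c\<in>P. lookup (f c) \<le> lookup (f b + Poly_Mapping.single v 1)}"
    define U where "U = (\<lambda>v. Poly_Mapping.single v (1::nat)) ` V"
    have le: "(\<exists>u\<in>U. lookup u \<le> lookup t) \<longleftrightarrow> (\<exists>a\<in>f ` P. lookup a \<le> lookup (t + f b))" for t
    proof
      assume "\<exists>u\<in>U. lookup u \<le> lookup t"
      then obtain v c where v: "lookup (Poly_Mapping.single v (1::nat)) \<le> lookup t" "c \<in> P"
        "lookup (f c) \<le> lookup (f b + Poly_Mapping.single v 1)"
        by (auto simp: U_def V_def)
      have "lookup (f c) \<le> lookup (t + f b)"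
      proof (rule le_funI)
        fix x
        show "lookup (f c) x \<le> lookup (t + f b) x"
          using le_funD[OF v(1), of x] le_funD[OF v(3), of x] by (simp add: lookup_add)
      qed
      then show "\<exists>a\<in>f ` P. lookup a \<le> lookup (t + f b)" using v by blast
    next
      assume "\<exists>a\<in>f ` P. lookup a \<le> lookup (t + f b)"
      then obtain a where a: "a \<in> P" "lookup (f a) \<le> lookup (t + f b)" by blast
      from exch[of a b] Pb[OF a(1)] b(1) obtain c v where
        c: "c \<in> T" "key c < key b" "lookup (f b) v < lookup (f a) v"
          "lookup (f c) \<le> lookup (f b + Poly_Mapping.single v 1)"
        by blast
      \<comment> \<open>The exponent of \<open>v\<close> is larger in \<open>f a\<close> than in
        \<open>f b\<close>, so \<open>t\<close> must supply the difference.\<close>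
      have "lookup t v \<ge> 1"
        using le_funD[OF a(2), of v] c(3) by (simp add: lookup_add)
      then have "lookup (Poly_Mapping.single v (1::nat)) \<le> lookup t"
        by (auto simp: le_fun_def lookup_single when_def)
      moreover have "v \<in> V" using c less_P V_def by blast
      ultimately show "\<exists>u\<in>U. lookup u \<le> lookup t" by (auto simp: U_def)
    qed
    have "ideal_colon (ideal_gen (monomial ` f ` P)) (monomial (f b)) =
        ideal_gen (monomial ` U :: ('v, 'k) mpoly set)"
      unfolding ideal_colon_def
      by (rule set_eqI) (simp only: mem_Collect_eq mem_ideal_gen_monomials keys_mult_monomial
          ball_simps le)
    moreover have "monomial ` U \<subseteq> (range var :: ('v, 'k) mpoly set)"
      by (auto simp: U_def var_def)
    ultimately show ?thesis unfolding take_ms b(2) by blast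
  qed
  ultimately show ?thesis
    unfolding linear_quotients_def by metis
qed

section \<open>Powers of a squarefree monomial ideal as products of its generators\<close>

definition exponent_of_product :: "('j \<Rightarrow> 'v::finite set) \<Rightarrow> 'j set \<Rightarrow> ('j \<Rightarrow> nat) \<Rightarrow> 'v \<Rightarrow>\<^sub>0 nat"
  where "exponent_of_product cov J m = Abs_poly_mapping (\<lambda>v. \<Sum>j\<in>{j \<in> J. v \<in> cov j}. m j)"

lemma lookup_exponent_of_product:
  "lookup (exponent_of_product cov J m) v = (\<Sum>j\<in>{j \<in> J. v \<in> cov j}. m j)"
  by (simp add: exponent_of_product_def)

text \<open>Multisets of size \<open>s\<close> on \<open>J\<close>. The value 0 outside
  \<open>J\<close> makes equal multisets equal functions.\<close>

definition multiplicities :: "'j set \<Rightarrow> nat \<Rightarrow> ('j \<Rightarrow> nat) set" where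
  "multiplicities J s = {m. (\<forall>j. j \<notin> J \<longrightarrow> m j = 0) \<and> sum m J = s}"

lemma finite_multiplicities:
  assumes "finite J"
  shows "finite (multiplicities J s)"
proof (rule finite_subset)
  show "multiplicities J s \<subseteq> {m. \<forall>j. (j \<in> J \<longrightarrow> m j \<in> {..s}) \<and> (j \<notin> J \<longrightarrow> m j = 0)}"
    using assms by (auto simp: multiplicities_def intro: member_le_sum)
  show "finite {m. \<forall>j. (j \<in> J \<longrightarrow> m j \<in> {..s}) \<and> (j \<notin> J \<longrightarrow> m j = 0)}"
    using assms by (intro finite_set_of_finite_funs) auto
qed

lemma prod_var_eq_monomial:
  fixes C :: "'v::finite set"
  shows "(\<Prod>v\<in>C. var v) =
    (monomial (Abs_poly_mapping (\<lambda>v. if v \<in> C then 1 else 0)) :: ('v, 'k::field) mpoly)"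
proof -
  have "(\<Prod>v\<in>C. var v) = (monomial (\<Sum>v\<in>C. Poly_Mapping.single v 1) :: ('v, 'k) mpoly)"
    by (induction rule: finite_induct[OF finite[of C]])
      (simp_all add: var_def monomial_add, simp add: monomial_def)
  moreover have "(\<Sum>v\<in>C. Poly_Mapping.single v 1) = Abs_poly_mapping (\<lambda>v. if v \<in> C then 1 else (0::nat))"
    by (rule poly_mapping_eqI) (simp add: lookup_sum lookup_single when_def)
  ultimately show ?thesis by simp
qed

lemma multiplicities_Suc_obtain:
  assumes "finite J" "m \<in> multiplicities J (Suc s)"
  obtains j n where "j \<in> J" "n \<in> multiplicities J s" "m = n(j := Suc (n j))"
proof -
  have "sum m J \<noteq> 0" using assms by (simp add: multiplicities_def)
  then obtain j where j: "j \<in> J" "m j \<noteq> 0" by (meson sum.neutral)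
  have "m(j := m j - 1) \<in> multiplicities J s"
    using assms j by (auto simp: multiplicities_def sum.remove[of J j])
  then show thesis using that[of j "m(j := m j - 1)"] j by simp
qed

lemma multiplicities_upd:
  assumes "finite J" "j \<in> J" "n \<in> multiplicities J s"
  shows "n(j := Suc (n j)) \<in> multiplicities J (Suc s)"
  using assms by (auto simp: multiplicities_def sum.remove[of J j])

lemma exponent_of_product_upd:
  assumes "finite J" "j \<in> J"
  shows "exponent_of_product cov J (n(j := Suc (n j))) =
    Abs_poly_mapping (\<lambda>v. if v \<in> cov j then 1 else 0) + exponent_of_product cov J n"
proof (rule poly_mapping_eqI)
  fix v
  show "lookup (exponent_of_product cov J (n(j := Suc (n j)))) v =
    lookup (Abs_poly_mapping (\<lambda>v. if v \<in> cov j then 1 else 0) + exponent_of_product cov J n) v"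
  proof (cases "v \<in> cov j")
    case True
    then have "j \<in> {i \<in> J. v \<in> cov i}" using assms by simp
    then show ?thesis
      using assms True by (simp add: lookup_add lookup_exponent_of_product sum.remove[of _ j])
  next
    case False
    then show ?thesis
      by (auto simp: lookup_add lookup_exponent_of_product intro!: sum.cong)
  qed
qed

text \<open>One more factor raises one multiplicity by one. For \<open>s = 0\<close> the empty
  product has exponent 0, and the constant 1 generates the whole ring.\<close>

lemma ideal_power_squarefree:
  fixes cov :: "'j \<Rightarrow> 'v::finite set"
  assumes "finite J"
  shows "ideal_power (ideal_gen ((\<lambda>j. \<Prod>v\<in>cov j. var v) ` J) :: ('v, 'k::field) mpoly set) s =
    ideal_gen (monomial ` exponent_of_product cov J ` multiplicities J s)"
proof (induction s)
  case 0
  have "multiplicities J 0 = {\<lambda>_. 0}"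
    using assms by (auto simp: multiplicities_def)
  moreover have "exponent_of_product cov J (\<lambda>_. 0) = 0"
    by (rule poly_mapping_eqI) (simp add: lookup_exponent_of_product)
  moreover have "x \<in> ideal_gen (monomial ` {0})" for x :: "('v, 'k) mpoly"
    by (simp only: mem_ideal_gen_monomials) (simp add: le_fun_def)
  ultimately show ?case by auto
next
  case (Suc s)
  define g where "g = (\<lambda>j. \<Prod>v\<in>cov j. var v :: ('v, 'k) mpoly)"
  define h where "h = (\<lambda>m. monomial (exponent_of_product cov J m) :: ('v, 'k) mpoly)"
  have gh: "g j * h n = h (n(j := Suc (n j)))" if "j \<in> J" for j n
    using that assms
    by (simp add: g_def h_def prod_var_eq_monomial exponent_of_product_upd monomial_add)
  have "{a * b | a b. a \<in> g ` J \<and> b \<in> h ` multiplicities J s} = h ` multiplicities J (Suc s)"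
  proof (intro equalityI subsetI)
    fix x assume "x \<in> {a * b | a b. a \<in> g ` J \<and> b \<in> h ` multiplicities J s}"
    then obtain j n where "x = g j * h n" "j \<in> J" "n \<in> multiplicities J s" by auto
    then show "x \<in> h ` multiplicities J (Suc s)"
      using gh multiplicities_upd assms by fastforce
  next
    fix x assume "x \<in> h ` multiplicities J (Suc s)"
    then obtain m where m: "m \<in> multiplicities J (Suc s)" "x = h m" by blast
    obtain j n where "j \<in> J" "n \<in> multiplicities J s" "m = n(j := Suc (n j))"
      using multiplicities_Suc_obtain[OF assms m(1)] .
    then have "x = g j * h n \<and> g j \<in> g ` J \<and> h n \<in> h ` multiplicities J s"
      using m(2) gh[of j n] by simp
    then show "x \<in> {a * b | a b. a \<in> g ` J \<and> b \<in> h ` multiplicities J s}"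
      by blast
  qed
  then show ?case
    using Suc by (simp add: ideal_prod_ideal_gen g_def h_def image_image)
qed

section \<open>Exchange arguments\<close>

text \<open>The number of factors that miss \<open>v\<close>, that is, \<open>s\<close> minus the
  exponent of \<open>v\<close>. It is easier to handle than the exponent because few covers miss a
  given vertex of the clique or the pentagon.\<close>

definition loss :: "('j \<Rightarrow> 'v set) \<Rightarrow> 'j set \<Rightarrow> ('j \<Rightarrow> nat) \<Rightarrow> 'v \<Rightarrow> nat" where
  "loss cov J m v = (\<Sum>j\<in>{j \<in> J. v \<notin> cov j}. m j)"

lemma lookup_exponent_plus_loss:
  assumes "finite J" "m \<in> multiplicities J s"
  shows "lookup (exponent_of_product cov J m) v + loss cov J m v = s"
proof -
  have "sum m J = sum m ({j \<in> J. v \<in> cov j} \<union> {j \<in> J. v \<notin> cov j})"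
    by (rule sum.cong) auto
  also have "\<dots> = sum m {j \<in> J. v \<in> cov j} + sum m {j \<in> J. v \<notin> cov j}"
    using assms(1) by (intro sum.union_disjoint) auto
  finally show ?thesis
    using assms(2) by (simp add: lookup_exponent_of_product loss_def multiplicities_def)
qed

text \<open>Exponent and loss add up to \<open>s\<close>, so the inequalities of
  \<open>linear_quotients_exchange\<close> reappear here reversed.\<close>

lemma linear_quotients_power_exchange:
  fixes cov :: "'j \<Rightarrow> 'v::finite set" and key :: "('j \<Rightarrow> nat) \<Rightarrow> 'b::linorder"
  assumes J: "finite J"
    and anti: "\<And>a b. a \<in> multiplicities J s \<Longrightarrow> b \<in> multiplicities J s \<Longrightarrow>
      (\<And>v. loss cov J b v \<le> loss cov J a v) \<Longrightarrow> a = b"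
    and exch: "\<And>a b. a \<in> multiplicities J s \<Longrightarrow> b \<in> multiplicities J s \<Longrightarrow> a \<noteq> b \<Longrightarrow>
      key a \<le> key b \<Longrightarrow>
      \<exists>c\<in>multiplicities J s. \<exists>v. key c < key b \<and> loss cov J a v < loss cov J b v \<and>
        (\<forall>x. loss cov J b x \<le> loss cov J c x + (if x = v then 1 else 0))"
  shows "linear_quotients
    (ideal_power (ideal_gen ((\<lambda>j. \<Prod>v\<in>cov j. var v) ` J) :: ('v, 'k::field) mpoly set) s)"
  unfolding ideal_power_squarefree[OF J]
proof (rule linear_quotients_exchange[where key = key])
  let ?T = "multiplicities J s"
  let ?f = "exponent_of_product cov J"
  show "finite ?T" by (rule finite_multiplicities[OF J])
  show "a = b" if ab: "a \<in> ?T" "b \<in> ?T" "lookup (?f a) \<le> lookup (?f b)" for a b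
  proof (rule anti[OF ab(1,2)])
    fix v
    show "loss cov J b v \<le> loss cov J a v"
      using le_funD[OF ab(3), of v] lookup_exponent_plus_loss[OF J ab(1), of cov v]
        lookup_exponent_plus_loss[OF J ab(2), of cov v] by linarith
  qed
  show "\<exists>c\<in>?T. \<exists>v. key c < key b \<and> lookup (?f b) v < lookup (?f a) v \<and>
        lookup (?f c) \<le> lookup (?f b + Poly_Mapping.single v 1)"
    if ab: "a \<in> ?T" "b \<in> ?T" "a \<noteq> b" "key a \<le> key b" for a b
  proof -
    obtain c v where c: "c \<in> ?T" "key c < key b" "loss cov J a v < loss cov J b v"
      "\<And>x. loss cov J b x \<le> loss cov J c x + (if x = v then 1 else 0)"
      using exch[OF ab] by blast
    have "lookup (?f b) v < lookup (?f a) v"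
      using c(3) lookup_exponent_plus_loss[OF J ab(1), of cov v]
        lookup_exponent_plus_loss[OF J ab(2), of cov v] by linarith
    moreover have "lookup (?f c) \<le> lookup (?f b + Poly_Mapping.single v 1)"
    proof (rule le_funI)
      fix x
      show "lookup (?f c) x \<le> lookup (?f b + Poly_Mapping.single v 1) x"
        using c(4)[of x] lookup_exponent_plus_loss[OF J c(1), of cov x]
          lookup_exponent_plus_loss[OF J ab(2), of cov x]
        by (auto simp: lookup_add lookup_single when_def split: if_splits)
    qed
    ultimately show ?thesis using c by blast
  qed
qed

section \<open>Trading a neighbourhood N(k) for a cover that contains the clique\<close>

lemma loss_Plus:
  assumes "finite K" "finite I"
  shows "loss cov (K <+> I) m v =
    (\<Sum>k\<in>{k \<in> K. v \<notin> cov (Inl k)}. m (Inl k)) + (\<Sum>i\<in>{i \<in> I. v \<notin> cov (Inr i)}. m (Inr i))"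
proof -
  have "{j \<in> K <+> I. v \<notin> cov j} = {k \<in> K. v \<notin> cov (Inl k)} <+> {i \<in> I. v \<notin> cov (Inr i)}"
    by auto
  then show ?thesis
    using assms by (simp add: loss_def sum.Plus)
qed

lemma multiplicities_Plus:
  assumes "finite K" "finite I"
  shows "m \<in> multiplicities (K <+> I) s \<longleftrightarrow>
    (\<forall>k. k \<notin> K \<longrightarrow> m (Inl k) = 0) \<and> (\<forall>i. i \<notin> I \<longrightarrow> m (Inr i) = 0) \<and>
    (\<Sum>k\<in>K. m (Inl k)) + (\<Sum>i\<in>I. m (Inr i)) = s"
proof -
  have "(\<forall>j. j \<notin> K <+> I \<longrightarrow> m j = 0) \<longleftrightarrow>
      (\<forall>k. k \<notin> K \<longrightarrow> m (Inl k) = 0) \<and> (\<forall>i. i \<notin> I \<longrightarrow> m (Inr i) = 0)"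
    by (auto elim: PlusE) (metis InlI InrI obj_sumE)
  then show ?thesis
    using assms by (simp add: multiplicities_def sum.Plus)
qed

text \<open>Replacing one factor \<open>cov p\<close> by \<open>cov q\<close> lowers the loss only
  at a vertex of \<open>cov q\<close> outside \<open>cov p\<close>, which can only be
  \<open>k\<close>, and there by one.\<close>

lemma loss_exchange_le:
  assumes "finite J" "p \<in> J" "q \<in> J" "p \<noteq> q" "m p > 0" and sub: "cov q \<subseteq> insert k (cov p)"
  shows "loss cov J m x \<le> loss cov J (m(p := m p - 1, q := Suc (m q))) x + (if x = k then 1 else 0)"
proof -
  let ?m = "m(p := m p - 1, q := Suc (m q))"
  \<comment> \<open>Splits off the two indices whose multiplicities change.\<close>
  have *: "(\<Sum>j\<in>{j \<in> J. x \<notin> cov j}. h j) = (if x \<notin> cov p then h p else 0) +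
      ((if x \<notin> cov q then h q else 0) + (\<Sum>j\<in>J - {p} - {q}. if x \<notin> cov j then h j else 0))"
    for h :: "'a \<Rightarrow> nat"
    using assms sum.remove[of J p "\<lambda>j. if x \<notin> cov j then h j else 0"]
      sum.remove[of "J - {p}" q "\<lambda>j. if x \<notin> cov j then h j else 0"]
    by (simp only: sum.inter_filter) simp
  have "(\<Sum>j\<in>J - {p} - {q}. if x \<notin> cov j then ?m j else 0) =
      (\<Sum>j\<in>J - {p} - {q}. if x \<notin> cov j then m j else 0)"
    by (rule sum.cong) auto
  then show ?thesis
    unfolding loss_def *[of m] *[of ?m] using assms(4,5) sub by auto
qed

text \<open>\<open>Inl k\<close> stands for the cover N(k), \<open>Inr i\<close> for a cover
  containing the clique. By \<open>cov_0\<close>, trading N(k) for the cover with index 0 gains no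
  vertex other than \<open>k\<close>.\<close>

context
  fixes K :: "'v::finite set" and cov :: "'v::finite + nat \<Rightarrow> 'v::finite set"
  assumes clique: "\<And>k k'. k \<in> K \<Longrightarrow> k' \<in> K \<Longrightarrow> k' \<in> cov (Inl k) \<longleftrightarrow> k' \<noteq> k"
    and K_sub: "\<And>k i. k \<in> K \<Longrightarrow> k \<in> cov (Inr i)"
    and cov_0: "\<And>k. k \<in> K \<Longrightarrow> cov (Inr 0) \<subseteq> insert k (cov (Inl k))"
begin

text \<open>Among all the covers only N(k) misses \<open>k\<close>, so the loss at \<open>k\<close>
  reads off its multiplicity.\<close>

lemma loss_clique:
  assumes "k \<in> K" "finite I"
  shows "loss cov (K <+> I) m k = m (Inl k)"
proof -
  have "{k' \<in> K. k \<notin> cov (Inl k')} = {k}"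
    using assms clique by auto
  moreover have "{i \<in> I. k \<notin> cov (Inr i)} = {}"
    using assms K_sub by auto
  ultimately show ?thesis using assms by (simp only: loss_Plus finite) simp
qed

text \<open>One copy of N(k) in \<open>b\<close> becomes a copy of the cover with index 0. The loss
  at \<open>k\<close> is the multiplicity of N(k), so \<open>v = k\<close> is a vertex where
  \<open>a\<close> loses less than \<open>b\<close>.\<close>

lemma clique_exchange:
  assumes "finite I" "0 \<in> I"
    and a: "a \<in> multiplicities (K <+> I) s" and b: "b \<in> multiplicities (K <+> I) s"
    and k: "k \<in> K" "a (Inl k) < b (Inl k)"
  shows "\<exists>c\<in>multiplicities (K <+> I) s. \<exists>v.
    (\<Sum>k\<in>K. c (Inl k)) < (\<Sum>k\<in>K. b (Inl k)) \<and>
    loss cov (K <+> I) a v < loss cov (K <+> I) b v \<and>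
    (\<forall>x. loss cov (K <+> I) b x \<le> loss cov (K <+> I) c x + (if x = v then 1 else 0))"
proof -
  define c where "c = b(Inl k := b (Inl k) - 1, Inr 0 := Suc (b (Inr 0)))"
  have sumK: "(\<Sum>k\<in>K. b (Inl k)) = Suc (\<Sum>k\<in>K. c (Inl k))"
  proof -
    have "(\<Sum>k'\<in>K - {k}. c (Inl k')) = (\<Sum>k'\<in>K - {k}. b (Inl k'))"
      by (rule sum.cong) (auto simp: c_def)
    then show ?thesis
      using k by (simp add: sum.remove[of K k]) (simp add: c_def)
  qed
  moreover have "(\<Sum>i\<in>I. c (Inr i)) = Suc (\<Sum>i\<in>I. b (Inr i))"
    using assms by (simp add: c_def sum.remove[of I 0])
  moreover have zero: "\<forall>k. k \<notin> K \<longrightarrow> c (Inl k) = 0" "\<forall>i. i \<notin> I \<longrightarrow> c (Inr i) = 0"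
    using assms(1,2) b k(1) by (auto simp: multiplicities_Plus c_def intro!: gr0I)
  ultimately have "c \<in> multiplicities (K <+> I) s"
    using assms(1,2) b zero by (simp add: multiplicities_Plus)
  moreover have "loss cov (K <+> I) a k < loss cov (K <+> I) b k"
    using k assms by (simp add: loss_clique)
  moreover have "\<forall>x. loss cov (K <+> I) b x \<le> loss cov (K <+> I) c x + (if x = k then 1 else 0)"
    unfolding c_def using assms cov_0 by (intro allI loss_exchange_le) auto
  ultimately show ?thesis using sumK by (metis lessI)
qed

text \<open>With a single cover containing \<open>K\<close>, the multiplicities of the N(k)
  determine the last one through the total. If \<open>a\<close> has no more of them than
  \<open>b\<close> and differs from \<open>b\<close>, then some N(k) occurs less often in
  \<open>a\<close>, and \<open>clique_exchange\<close> applies.\<close>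

lemma linear_quotients_split:
  assumes nbr: "\<And>k. k \<in> K \<Longrightarrow> \<exists>v. v \<in> cov (Inl k) \<and> v \<notin> cov (Inr 0)"
  shows "linear_quotients (ideal_power
    (ideal_gen ((\<lambda>j. \<Prod>v\<in>cov j. var v) ` (K <+> {0})) :: ('v, 'k::field) mpoly set) s)"
proof (rule linear_quotients_power_exchange[where key = "\<lambda>m. \<Sum>k\<in>K. m (Inl k)"])
  let ?T = "multiplicities (K <+> {0::nat}) s"
  have eqI: "a = b" if "a \<in> ?T" "b \<in> ?T" "\<And>k. k \<in> K \<Longrightarrow> a (Inl k) = b (Inl k)" for a b
  proof
    fix j
    have "(\<Sum>k\<in>K. a (Inl k)) = (\<Sum>k\<in>K. b (Inl k))" using that by simp
    then have "a (Inr 0) = b (Inr 0)" using that by (auto simp: multiplicities_Plus)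
    then show "a j = b j"
    proof (cases j)
      case (Inl k)
      then show ?thesis using that by (cases "k \<in> K") (simp_all add: multiplicities_Plus)
    next
      case (Inr i)
      then show ?thesis
        using that \<open>a (Inr 0) = b (Inr 0)\<close> by (cases "i = 0") (simp_all add: multiplicities_Plus)
    qed
  qed
  show "a = b" if ab: "a \<in> ?T" "b \<in> ?T"
    "\<And>v. loss cov (K <+> {0}) b v \<le> loss cov (K <+> {0}) a v" for a b
  proof (rule eqI[OF ab(1,2)])
    have le: "b (Inl k) \<le> a (Inl k)" if "k \<in> K" for k
      using ab(3)[of k] that by (simp add: loss_clique)
    fix k assume k: "k \<in> K"
    \<comment> \<open>The factors containing \<open>v\<close> are exactly those N(k) with
      \<open>k\<close> in \<open>A\<close>. At \<open>v\<close> the exponent of \<open>a\<close> is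
      at most that of \<open>b\<close>, although each multiplicity in \<open>a\<close> is at least
      that in \<open>b\<close>; hence they agree on \<open>A\<close>.\<close>
    then obtain v where v: "v \<in> cov (Inl k)" "v \<notin> cov (Inr 0)" using nbr by blast
    define A where "A = {k \<in> K. v \<in> cov (Inl k)}"
    have tot: "(\<Sum>k\<in>A. m (Inl k)) + loss cov (K <+> {0}) m v = s" if "m \<in> ?T" for m
    proof -
      have "{i \<in> {0}. v \<notin> cov (Inr i)} = {0}" using v by auto
      moreover have "(\<Sum>k\<in>K. m (Inl k)) =
          (\<Sum>k\<in>A. m (Inl k)) + (\<Sum>k\<in>{k \<in> K. v \<notin> cov (Inl k)}. m (Inl k))"
        unfolding A_def by (subst sum.union_disjoint[symmetric]) (auto intro: sum.cong)
      ultimately show ?thesis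
        using that by (simp add: loss_Plus multiplicities_Plus)
    qed
    have "(\<Sum>k\<in>A. a (Inl k)) \<le> (\<Sum>k\<in>A. b (Inl k))"
      using tot[OF ab(1)] tot[OF ab(2)] ab(3)[of v] by linarith
    moreover have "k \<in> A" using k v by (simp add: A_def)
    moreover have "\<And>k. k \<in> A \<Longrightarrow> b (Inl k) \<le> a (Inl k)" using le by (simp add: A_def)
    ultimately have "\<not> b (Inl k) < a (Inl k)"
      using sum_strict_mono_ex1[of A "\<lambda>k. b (Inl k)" "\<lambda>k. a (Inl k)"]
      by (meson finite leD)
    then show "a (Inl k) = b (Inl k)" using le[OF k] by simp
  qed
  show "\<exists>c\<in>?T. \<exists>v. (\<Sum>k\<in>K. c (Inl k)) < (\<Sum>k\<in>K. b (Inl k)) \<and>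
    loss cov (K <+> {0}) a v < loss cov (K <+> {0}) b v \<and>
    (\<forall>x. loss cov (K <+> {0}) b x \<le> loss cov (K <+> {0}) c x + (if x = v then 1 else 0))"
    if ab: "a \<in> ?T" "b \<in> ?T" "a \<noteq> b" "(\<Sum>k\<in>K. a (Inl k)) \<le> (\<Sum>k\<in>K. b (Inl k))" for a b
  proof -
    have "\<exists>k\<in>K. a (Inl k) < b (Inl k)"
    proof (rule ccontr)
      assume "\<not> ?thesis"
      then have ge: "\<And>k. k \<in> K \<Longrightarrow> b (Inl k) \<le> a (Inl k)" by (meson not_le)
      then have "a (Inl k) = b (Inl k)" if "k \<in> K" for k
        using that sum_strict_mono_ex1[of K "\<lambda>k. b (Inl k)" "\<lambda>k. a (Inl k)"] ab(4)
        by (metis finite leD le_neq_implies_less)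
      then show False using eqI ab by blast
    qed
    then obtain k where "k \<in> K" "a (Inl k) < b (Inl k)" by blast
    then show ?thesis using clique_exchange[of "{0}" a s b k] ab by simp
  qed
qed simp

end

section \<open>Exchanges among the five minimal covers of the pentagon\<close>

lemma all_less_5: "(\<forall>i<5::nat. P i) \<longleftrightarrow> P 0 \<and> P 1 \<and> P 2 \<and> P 3 \<and> P 4"
  by (auto simp: less_Suc_eq numeral_eq_Suc)

text \<open>Larger entries come first; the entry with index 3 is determined by the total.\<close>

definition cycle_key :: "(nat \<Rightarrow> nat) \<Rightarrow> int \<times> int \<times> int \<times> int" where
  "cycle_key e = (- int (e 0), - int (e 1), - int (e 4), - int (e 2))"

lemma sum_less_5: "(\<Sum>i<5. f i) = f 0 + f 1 + f 2 + f 3 + f (4::nat)" for f :: "nat \<Rightarrow> nat"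
  by (simp add: numeral_eq_Suc)

text \<open>
  The cover \<open>F\<^sub>i\<close> of the pentagon misses the vertices \<open>i\<close> and \<open>i - 1\<close>, so a product with multiplicities
  \<open>e\<close> misses the vertex \<open>i\<close> exactly \<open>e\<^sub>i + e\<^sub>i\<^sub>+\<^sub>1\<close> times.
\<close>

lemma cycle_exchange:
  fixes e f :: "nat \<Rightarrow> nat"
  assumes tot: "(\<Sum>i<5. f i) = (\<Sum>i<5. e i)" and key: "cycle_key f \<le> cycle_key e"
    and neq: "\<exists>i<5. f i \<noteq> e i"
  shows "\<exists>g v. v < 5 \<and> (\<Sum>i<5. g i) = (\<Sum>i<5. e i) \<and> (\<forall>i\<ge>5. g i = e i) \<and>
    cycle_key g < cycle_key e \<and>
    f v + f (Suc v mod 5) < e v + e (Suc v mod 5) \<and>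
    (\<forall>x<5. e x + e (Suc x mod 5) \<le> g x + g (Suc x mod 5) + (if x = v then 1 else 0))"
    (is "\<exists>g v. ?P g v")
proof -
  have neq': "f 0 \<noteq> e 0 \<or> f 1 \<noteq> e 1 \<or> f 2 \<noteq> e 2 \<or> f 3 \<noteq> e 3 \<or> f 4 \<noteq> e 4"
    using neq all_less_5[of "\<lambda>i. f i = e i"] by blast
  have tot': "f 0 + f 1 + f 2 + f 3 + f 4 = e 0 + e 1 + e 2 + e 3 + e 4"
    using tot unfolding sum_less_5 .
  have key': "e 0 < f 0 \<or> e 0 = f 0 \<and> e 1 < f 1 \<or> e 0 = f 0 \<and> e 1 = f 1 \<and> e 4 < f 4 \<or>
      e 0 = f 0 \<and> e 1 = f 1 \<and> e 4 = f 4 \<and> e 2 < f 2"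
  proof -
    \<comment> \<open>Equality in the four compared entries would force equality at 3 through the
      total, against \<open>neq\<close>.\<close>
    have "e 2 < f 2" if "e 0 = f 0" "e 1 = f 1" "e 4 = f 4" "e 2 \<le> f 2"
      using that neq' tot' by linarith
    then show ?thesis using key by (auto simp: cycle_key_def)
  qed
  \<comment> \<open>Some vertex other than 0 has smaller loss in \<open>f\<close>, and
    \<open>e\<close> still contains the factors needed for an exchange there. The contrary is a
    linear system incompatible with the total and \<open>key'\<close>.\<close>
  have "f 2 + f 3 < e 2 + e 3 \<or> f 3 + f 4 < e 3 + e 4 \<or>
      f 1 + f 2 < e 1 + e 2 \<and> (e 1 > 0 \<or> e 2 > 0 \<and> e 4 > 0) \<or>
      f 4 + f 0 < e 4 + e 0 \<and> e 4 > 0 \<and> e 2 > 0"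
  proof (rule ccontr)
    assume "\<not> ?thesis"
    then have "e 2 + e 3 \<le> f 2 + f 3" "e 3 + e 4 \<le> f 3 + f 4"
        "e 1 + e 2 \<le> f 1 + f 2 \<or> e 1 = 0 \<and> e 2 = 0 \<or> e 1 = 0 \<and> e 4 = 0"
        "e 4 + e 0 \<le> f 4 + f 0 \<or> e 4 = 0 \<or> e 2 = 0"
      by (simp_all add: not_less) blast
    then show False
      using tot' key' by (elim disjE conjE) linarith+
  qed
  moreover have "f 2 + f 3 < e 2 + e 3 \<Longrightarrow> e 2 > 0 \<or> e 3 > 0" "f 3 + f 4 < e 3 + e 4 \<Longrightarrow> e 3 > 0 \<or> e 4 > 0"
    by linarith+
  ultimately have "f 1 + f 2 < e 1 + e 2 \<and> e 1 > 0 \<or>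
      f 1 + f 2 < e 1 + e 2 \<and> e 2 > 0 \<and> e 4 > 0 \<or>
      f 2 + f 3 < e 2 + e 3 \<and> e 2 > 0 \<or> f 2 + f 3 < e 2 + e 3 \<and> e 3 > 0 \<or>
      f 3 + f 4 < e 3 + e 4 \<and> e 3 > 0 \<or> f 3 + f 4 < e 3 + e 4 \<and> e 4 > 0 \<or>
      f 4 + f 0 < e 4 + e 0 \<and> e 4 > 0 \<and> e 2 > 0"
    by argo
  then show ?thesis
  \<comment> \<open>Moving one copy from a cover to a cyclic neighbour keeps the loss at the vertex
    they both miss; of the other two vertices involved, one loses one less and the other one more.
    In each case the first entry changed in the order 0, 1, 4, 2 grows, so the key drops.\<close>
  proof (elim disjE)
    assume "f 1 + f 2 < e 1 + e 2 \<and> e 1 > 0"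
    then have "?P (e(1 := e 1 - 1, 0 := e 0 + 1)) 1"
      unfolding all_less_5 sum_less_5 cycle_key_def by (simp add: numeral_2_eq_2)
    then show ?thesis by blast
  next
    assume "f 1 + f 2 < e 1 + e 2 \<and> e 2 > 0 \<and> e 4 > 0"
    \<comment> \<open>A double move: the move from 4 to 0 cancels the rise at vertex 3 against its
      own drop there.\<close>
    then have "?P (e(2 := e 2 - 1, 3 := e 3 + 1, 4 := e 4 - 1, 0 := e 0 + 1)) 1"
      unfolding all_less_5 sum_less_5 cycle_key_def by (simp add: numeral_2_eq_2)
    then show ?thesis by blast
  next
    assume "f 2 + f 3 < e 2 + e 3 \<and> e 2 > 0"
    then have "?P (e(2 := e 2 - 1, 1 := e 1 + 1)) 2"
      unfolding all_less_5 sum_less_5 cycle_key_def by (simp add: numeral_2_eq_2)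
    then show ?thesis by blast
  next
    assume "f 2 + f 3 < e 2 + e 3 \<and> e 3 > 0"
    then have "?P (e(3 := e 3 - 1, 4 := e 4 + 1)) 2"
      unfolding all_less_5 sum_less_5 cycle_key_def by (simp add: numeral_2_eq_2)
    then show ?thesis by blast
  next
    assume "f 3 + f 4 < e 3 + e 4 \<and> e 3 > 0"
    then have "?P (e(3 := e 3 - 1, 2 := e 2 + 1)) 3"
      unfolding all_less_5 sum_less_5 cycle_key_def by (simp add: numeral_2_eq_2)
    then show ?thesis by blast
  next
    assume "f 3 + f 4 < e 3 + e 4 \<and> e 4 > 0"
    then have "?P (e(4 := e 4 - 1, 0 := e 0 + 1)) 3"
      unfolding all_less_5 sum_less_5 cycle_key_def by (simp add: numeral_2_eq_2)
    then show ?thesis by blast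
  next
    assume "f 4 + f 0 < e 4 + e 0 \<and> e 4 > 0 \<and> e 2 > 0"
    \<comment> \<open>Again a double move: the two changes at vertex 2 cancel and only vertex 4
      drops.\<close>
    then have "?P (e(4 := e 4 - 1, 3 := e 3 + 1, 2 := e 2 - 1, 1 := e 1 + 1)) 4"
      unfolding all_less_5 sum_less_5 cycle_key_def by (simp add: numeral_2_eq_2)
    then show ?thesis by blast
  qed
qed


section \<open>Linear quotients in the presence of a pentagon\<close>

context
  fixes K :: "'v::finite set" and cov :: "'v + nat \<Rightarrow> 'v::finite set" and u :: "nat \<Rightarrow> 'v"
  assumes clique: "\<And>k k'. k \<in> K \<Longrightarrow> k' \<in> K \<Longrightarrow> k' \<in> cov (Inl k) \<longleftrightarrow> k' \<noteq> k"
    and K_sub: "\<And>k i. k \<in> K \<Longrightarrow> k \<in> cov (Inr i)"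
    and cov_0: "\<And>k. k \<in> K \<Longrightarrow> cov (Inr 0) \<subseteq> insert k (cov (Inl k))"
    and u_K: "\<And>k i. k \<in> K \<Longrightarrow> i < 5 \<Longrightarrow> u i \<in> cov (Inl k)"
    and u_cov: "\<And>i j. i < 5 \<Longrightarrow> j < 5 \<Longrightarrow> u j \<in> cov (Inr i) \<longleftrightarrow> i \<noteq> j \<and> i \<noteq> Suc j mod 5"
    and cov_const: "\<And>v i. v \<notin> u ` {..<5} \<Longrightarrow> i < 5 \<Longrightarrow> v \<in> cov (Inr i) \<longleftrightarrow> v \<in> cov (Inr 0)"
begin

lemma loss_cycle:
  assumes "j < 5"
  shows "loss cov (K <+> {..<5}) m (u j) = m (Inr j) + m (Inr (Suc j mod 5))"
proof -
  have "{k \<in> K. u j \<notin> cov (Inl k)} = {}" using assms u_K by auto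
  moreover have "{i \<in> {..<5}. u j \<notin> cov (Inr i)} = {j, Suc j mod 5}"
    using assms u_cov by auto
  \<comment> \<open>Ensures that the two missing covers are different, so that the sum has two
    terms.\<close>
  moreover have "j \<noteq> Suc j mod 5" using assms by presburger
  ultimately show ?thesis by (simp only: loss_Plus finite finite_lessThan) simp
qed

lemma loss_clique_5: "k \<in> K \<Longrightarrow> loss cov (K <+> {..<5}) m k = m (Inl k)"
  by (rule loss_clique[OF clique K_sub cov_0]) auto

text \<open>If some N(k) is rarer in \<open>a\<close> than in \<open>b\<close>,
  \<open>clique_exchange\<close> lowers the first component of the key. Otherwise the clique parts
  coincide, the comparison passes to \<open>cycle_key\<close>, and \<open>cycle_exchange\<close>
  supplies the new pentagon part.\<close>

lemma linear_quotients_pseudo_split: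
  "linear_quotients (ideal_power
    (ideal_gen ((\<lambda>j. \<Prod>v\<in>cov j. var v) ` (K <+> {..<5})) :: ('v, 'k::field) mpoly set) s)"
proof (rule linear_quotients_power_exchange
    [where key = "\<lambda>m. ((\<Sum>k\<in>K. m (Inl k)), cycle_key (\<lambda>i. m (Inr i)))"])
  let ?T = "multiplicities (K <+> {..<5::nat}) s"
  let ?L = "loss cov (K <+> {..<5})"
  have eqI: "a = b" if "a \<in> ?T" "b \<in> ?T" "\<And>k. k \<in> K \<Longrightarrow> a (Inl k) = b (Inl k)"
    "\<And>i. i < 5 \<Longrightarrow> a (Inr i) = b (Inr i)" for a b
  proof
    fix j
    show "a j = b j"
    proof (cases j)
      case (Inl k)
      then show ?thesis using that by (cases "k \<in> K") (simp_all add: multiplicities_Plus)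
    next
      case (Inr i)
      then show ?thesis using that by (cases "i < 5") (simp_all add: multiplicities_Plus)
    qed
  qed
  have K_eq: "a (Inl k) = b (Inl k)"
    if "\<And>k. k \<in> K \<Longrightarrow> b (Inl k) \<le> a (Inl k)" "(\<Sum>k\<in>K. a (Inl k)) \<le> (\<Sum>k\<in>K. b (Inl k))" "k \<in> K"
    for a b :: "'v + nat \<Rightarrow> nat" and k
    using that sum_strict_mono_ex1[of K "\<lambda>k. b (Inl k)" "\<lambda>k. a (Inl k)"]
    by (metis finite leD le_neq_implies_less)
  show "a = b" if ab: "a \<in> ?T" "b \<in> ?T" "\<And>v. ?L b v \<le> ?L a v" for a b
  proof -
    have le: "b (Inl k) \<le> a (Inl k)" if "k \<in> K" for k
      using ab(3)[of k] that by (simp add: loss_clique_5)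
    have "\<forall>j<5. b (Inr j) + b (Inr (Suc j mod 5)) \<le> a (Inr j) + a (Inr (Suc j mod 5))"
      using ab(3) loss_cycle by metis
    then have le5: "b (Inr 0) + b (Inr 1) \<le> a (Inr 0) + a (Inr 1)"
      "b (Inr 1) + b (Inr 2) \<le> a (Inr 1) + a (Inr 2)"
      "b (Inr 2) + b (Inr 3) \<le> a (Inr 2) + a (Inr 3)"
      "b (Inr 3) + b (Inr 4) \<le> a (Inr 3) + a (Inr 4)"
      "b (Inr 4) + b (Inr 0) \<le> a (Inr 4) + a (Inr 0)"
      unfolding all_less_5 by (simp_all add: numeral_2_eq_2)
    have tot: "(\<Sum>k\<in>K. a (Inl k)) + (a (Inr 0) + a (Inr 1) + a (Inr 2) + a (Inr 3) + a (Inr 4)) =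
        (\<Sum>k\<in>K. b (Inl k)) + (b (Inr 0) + b (Inr 1) + b (Inr 2) + b (Inr 3) + b (Inr 4))"
      using ab(1,2) by (simp add: multiplicities_Plus sum_less_5)
    have geK: "(\<Sum>k\<in>K. b (Inl k)) \<le> (\<Sum>k\<in>K. a (Inl k))"
      by (rule sum_mono) (rule le)
    \<comment> \<open>Adding the five inequalities counts each pentagon multiplicity twice, so
      \<open>a\<close> has at least as many pentagon factors as \<open>b\<close>.\<close>
    have "(\<Sum>k\<in>K. a (Inl k)) \<le> (\<Sum>k\<in>K. b (Inl k))"
      using le5 tot by linarith
    then have eqK: "a (Inl k) = b (Inl k)" if "k \<in> K" for k
      using K_eq le that by blast
    \<comment> \<open>All five inequalities are now equalities, and the sums of cyclically
      consecutive entries determine the entries because 5 is odd.\<close>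
    have "a (Inr 0) = b (Inr 0)" "a (Inr 1) = b (Inr 1)" "a (Inr 2) = b (Inr 2)"
      "a (Inr 3) = b (Inr 3)" "a (Inr 4) = b (Inr 4)"
      using le5 tot geK by linarith+
    then have "\<forall>i<5. a (Inr i) = b (Inr i)"
      unfolding all_less_5 by blast
    then show ?thesis using eqI[OF ab(1,2)] eqK by blast
  qed
  show "\<exists>c\<in>?T. \<exists>v. ((\<Sum>k\<in>K. c (Inl k)), cycle_key (\<lambda>i. c (Inr i))) <
      ((\<Sum>k\<in>K. b (Inl k)), cycle_key (\<lambda>i. b (Inr i))) \<and>
    ?L a v < ?L b v \<and> (\<forall>x. ?L b x \<le> ?L c x + (if x = v then 1 else 0))"
    if ab: "a \<in> ?T" "b \<in> ?T" "a \<noteq> b" and key: "((\<Sum>k\<in>K. a (Inl k)), cycle_key (\<lambda>i. a (Inr i))) \<le>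
      ((\<Sum>k\<in>K. b (Inl k)), cycle_key (\<lambda>i. b (Inr i)))" for a b
  proof (cases "\<exists>k\<in>K. a (Inl k) < b (Inl k)")
    case True
    then obtain k where k: "k \<in> K" "a (Inl k) < b (Inl k)" by blast
    have "\<exists>c\<in>?T. \<exists>v. (\<Sum>k\<in>K. c (Inl k)) < (\<Sum>k\<in>K. b (Inl k)) \<and>
        ?L a v < ?L b v \<and> (\<forall>x. ?L b x \<le> ?L c x + (if x = v then 1 else 0))"
      by (rule clique_exchange[OF clique K_sub cov_0 _ _ ab(1,2) k]) auto
    then show ?thesis unfolding less_prod_simp by blast
  next
    case False
    then have ge: "\<And>k. k \<in> K \<Longrightarrow> b (Inl k) \<le> a (Inl k)" by (meson not_le)
    moreover have leK: "(\<Sum>k\<in>K. a (Inl k)) \<le> (\<Sum>k\<in>K. b (Inl k))"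
      using key by auto
    ultimately have eqK: "a (Inl k) = b (Inl k)" if "k \<in> K" for k
      using K_eq that by blast
    then have sumK: "(\<Sum>k\<in>K. a (Inl k)) = (\<Sum>k\<in>K. b (Inl k))" by (rule sum.cong[OF refl])
    have "cycle_key (\<lambda>i. a (Inr i)) \<le> cycle_key (\<lambda>i. b (Inr i))"
      using key sumK by simp
    moreover have "\<exists>i<5. a (Inr i) \<noteq> b (Inr i)"
      using eqI[OF ab(1,2)] eqK ab(3) by blast
    moreover have "(\<Sum>i<5. a (Inr i)) = (\<Sum>i<5. b (Inr i))"
      using ab(1,2) sumK by (simp add: multiplicities_Plus)
    ultimately obtain g v where g: "v < 5" "(\<Sum>i<5. g i) = (\<Sum>i<5. b (Inr i))"
      "\<And>i. i \<ge> 5 \<Longrightarrow> g i = b (Inr i)" "cycle_key g < cycle_key (\<lambda>i. b (Inr i))"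
      "a (Inr v) + a (Inr (Suc v mod 5)) < b (Inr v) + b (Inr (Suc v mod 5))"
      "\<And>x. x < 5 \<Longrightarrow> b (Inr x) + b (Inr (Suc x mod 5)) \<le> g x + g (Suc x mod 5) + (if x = v then 1 else 0)"
      using cycle_exchange[of "\<lambda>i. a (Inr i)" "\<lambda>i. b (Inr i)"] by blast
    define c where "c = case_sum (\<lambda>k. b (Inl k)) g"
    have c_simps: "\<And>k. c (Inl k) = b (Inl k)" "\<And>i. c (Inr i) = g i" by (simp_all add: c_def)
    have "c \<in> ?T"
      using ab(2) g(2,3) by (simp add: multiplicities_Plus c_simps not_less)
    moreover have "((\<Sum>k\<in>K. c (Inl k)), cycle_key (\<lambda>i. c (Inr i))) <
        ((\<Sum>k\<in>K. b (Inl k)), cycle_key (\<lambda>i. b (Inr i)))"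
      using g(4) by (simp add: c_simps)
    moreover have "?L a (u v) < ?L b (u v)"
      using g(1,5) by (simp only: loss_cycle)
    moreover have "?L b x \<le> ?L c x + (if x = u v then 1 else 0)" for x
    proof (cases "x \<in> u ` {..<5}")
      case True
      then obtain j where j: "j < 5" "x = u j" by auto
      have "(if j = v then 1 else 0) \<le> (if x = u v then 1 else (0::nat))"
        using j by simp
      then show ?thesis
        using g(6)[OF j(1)] j by (simp only: loss_cycle c_simps)
    next
      case False
      \<comment> \<open>Off the pentagon the five covers agree, so the loss depends only on their
        total multiplicity, which \<open>g\<close> preserves.\<close>
      then have "{i \<in> {..<5}. x \<notin> cov (Inr i)} = (if x \<in> cov (Inr 0) then {} else {..<5})"
        using cov_const[OF False] by (cases "x \<in> cov (Inr 0)") (simp_all, blast+)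
      then show ?thesis
        using g(2) by (simp add: loss_Plus c_simps)
    qed
    ultimately show ?thesis by blast
  qed
qed simp

end

section \<open>Minimal vertex covers of pseudo-split graphs\<close>

definition minimal_cover :: "('v \<Rightarrow> 'v \<Rightarrow> bool) \<Rightarrow> 'v set \<Rightarrow> bool" where
  "minimal_cover E C \<longleftrightarrow> (\<forall>x y. E x y \<longrightarrow> x \<in> C \<or> y \<in> C) \<and> (\<forall>c\<in>C. \<exists>x. x \<notin> C \<and> E c x)"

text \<open>Deleting \<open>c\<close> from a cover leaves an edge uncovered exactly when
  \<open>c\<close> has a neighbour outside the cover. Supersets of covers are covers, so single
  deletions decide minimality.\<close>

lemma minimal_vertex_cover_iff:
  assumes "simple_graph G" "verts G = UNIV"
  shows "minimal_vertex_cover G C \<longleftrightarrow> minimal_cover (adj G) C"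
proof -
  have edge: "\<exists>x y. e = {x, y}" if "e \<in> edges G" for e
    using assms(1) that unfolding simple_graph_def all_pairs_def by blast
  have cover: "vertex_cover G D \<longleftrightarrow> (\<forall>x y. adj G x y \<longrightarrow> x \<in> D \<or> y \<in> D)" for D
  proof
    assume "vertex_cover G D"
    then show "\<forall>x y. adj G x y \<longrightarrow> x \<in> D \<or> y \<in> D"
      unfolding vertex_cover_def by fastforce
  next
    assume D: "\<forall>x y. adj G x y \<longrightarrow> x \<in> D \<or> y \<in> D"
    have "e \<inter> D \<noteq> {}" if e: "e \<in> edges G" for e
    proof -
      obtain x y where "e = {x, y}" using edge[OF e] by blast
      then show ?thesis using D e by auto
    qed
    then show "vertex_cover G D"
      by (simp add: vertex_cover_def assms(2))
  qed
  show ?thesis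
  proof
    assume min: "minimal_vertex_cover G C"
    then have C: "vertex_cover G C" by (simp add: minimal_vertex_cover_def)
    have "\<exists>x. x \<notin> C \<and> adj G c x" if c: "c \<in> C" for c
    proof -
      have "\<not> vertex_cover G (C - {c})"
        using min c unfolding minimal_vertex_cover_def by blast
      then obtain x y where xy: "adj G x y" "x \<notin> C - {c}" "y \<notin> C - {c}"
        unfolding cover by blast
      have "x = c \<and> y \<notin> C \<or> y = c \<and> x \<notin> C"
        using C xy adj_irrefl[OF assms(1)] unfolding cover by blast
      then show ?thesis
        using xy(1) adj_sym[of x y G] by blast
    qed
    then show "minimal_cover (adj G) C"
      using C unfolding minimal_cover_def cover by blast
  next
    assume "minimal_cover (adj G) C"
    then show "minimal_vertex_cover G C"
      unfolding minimal_cover_def minimal_vertex_cover_def cover by blast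
  qed
qed

lemma vertex_cover_ideal_eq:
  assumes "simple_graph G" "verts G = UNIV" "{C. minimal_cover (adj G) C} = cov ` J"
  shows "vertex_cover_ideal G = ideal_gen ((\<lambda>j. \<Prod>v\<in>cov j. var v) ` J)"
proof -
  have "{(\<Prod>v\<in>C. var v) | C. minimal_vertex_cover G C} =
      (\<lambda>C. \<Prod>v\<in>C. var v) ` {C. minimal_cover (adj G) C}"
    using minimal_vertex_cover_iff[OF assms(1,2)] by auto
  then show ?thesis
    unfolding vertex_cover_ideal_def assms(3) image_image by (rule arg_cong)
qed

text \<open>A minimal cover containing \<open>K\<close> equals \<open>K\<close>, since other
  vertices have all their neighbours in \<open>K\<close>. One that misses \<open>k\<close> contains
  N(k) and the rest of \<open>K\<close>; any further member would need a neighbour outside the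
  cover, which could only be \<open>k\<close>.\<close>

lemma (in C4_2K2_free) minimal_covers_split:
  assumes K: "clique E K" "independent_set E (- K)" "\<And>k. k \<in> K \<Longrightarrow> \<exists>v. v \<notin> K \<and> E k v"
  shows "{C. minimal_cover E C} = case_sum (\<lambda>k. {v. E k v}) (\<lambda>_. K) ` (K <+> {0::nat})"
proof (intro equalityI subsetI)
  fix C assume "C \<in> {C. minimal_cover E C}"
  then have C: "\<And>x y. E x y \<Longrightarrow> x \<in> C \<or> y \<in> C" "\<And>c. c \<in> C \<Longrightarrow> \<exists>x. x \<notin> C \<and> E c x"
    by (auto simp: minimal_cover_def)
  show "C \<in> case_sum (\<lambda>k. {v. E k v}) (\<lambda>_. K) ` (K <+> {0::nat})"
  proof (cases "K \<subseteq> C")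
    case True
    then have "C = K"
      using C(2) K(2) unfolding independent_set_def by blast
    then show ?thesis by force
  next
    case False
    then obtain k where k: "k \<in> K" "k \<notin> C" by blast
    have "C = {v. E k v}"
    proof (intro equalityI subsetI CollectI)
      fix c assume "c \<in> C"
      then obtain x where x: "x \<notin> C" "E c x" using C(2) by blast
      show "E k c"
      proof (cases "c \<in> K")
        case True
        then show ?thesis using K(1) k True \<open>c \<in> C\<close> unfolding clique_def by metis
      next
        case False
        then have "x \<in> K" using K(2) x unfolding independent_set_def by blast
        then have "x = k" using K(1) C(1) x k unfolding clique_def by blast
        then show ?thesis using x sym by blast
      qed
    qed (use C(1) k in blast)
    then show ?thesis using k by force
  qed
next
  fix C assume "C \<in> case_sum (\<lambda>k. {v. E k v}) (\<lambda>_. K) ` (K <+> {0::nat})"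
  then consider "C = K" | k where "k \<in> K" "C = {v. E k v}" by auto
  then have "minimal_cover E C"
  proof cases
    case 1
    then show ?thesis
      using K(2,3) unfolding minimal_cover_def independent_set_def by blast
  next
    case 2
    have K_C: "x = k" if "x \<in> K" "x \<notin> C" for x
      using K(1) 2 that unfolding clique_def by (metis mem_Collect_eq)
    have "x \<in> C \<or> y \<in> C" if E: "E x y" for x y
    proof (cases "x \<in> K \<or> y \<in> K")
      case True
      then show ?thesis
        using K_C[of x] K_C[of y] 2(2) E sym[of x y] by blast
    next
      case False
      then show ?thesis using K(2) E unfolding independent_set_def by blast
    qed
    moreover have "k \<notin> C" using 2(2) irrefl by simp
    moreover have "E c k" if "c \<in> C" for c using that 2(2) sym[of c k] by simp
    ultimately show ?thesis unfolding minimal_cover_def by blast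
  qed
  then show "C \<in> {C. minimal_cover E C}" by simp
qed

text \<open>The pentagon is indexed so that consecutive vertices are the non-adjacent ones.\<close>

lemma (in C4_2K2_free) ex_pseudo_split_partition:
  assumes C5: "induced_C5 E a b c d e"
  obtains K u where "clique E K" "independent_set E (- (K \<union> u ` {..<5::nat}))"
    "\<forall>i<5. u i \<notin> K" "\<forall>k\<in>K. \<forall>i<5. E k (u i)" "\<forall>s. s \<notin> K \<longrightarrow> s \<notin> u ` {..<5} \<longrightarrow> (\<forall>i<5. \<not> E s (u i))"
    "\<forall>i<5. \<forall>j<5. E (u i) (u j) \<longleftrightarrow> i \<noteq> j \<and> j \<noteq> Suc i mod 5 \<and> i \<noteq> Suc j mod 5"
proof -
  define u where "u = (!) [a, c, e, b, d]"
  \<comment> \<open>The vertices complete to the pentagon; \<open>none\<close> shows that all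
    remaining outside vertices have no neighbour on it.\<close>
  define K where "K = {v. v \<notin> {a, b, c, d, e} \<and> E v a \<and> E v b \<and> E v c \<and> E v d \<and> E v e}"
  have u: "u 0 = a" "u 1 = c" "u 2 = e" "u 3 = b" "u 4 = d"
    by (simp_all add: u_def)
  have "{..<5::nat} = {0, 1, 2, 3, 4}" by auto
  then have U: "u ` {..<5} = {a, b, c, d, e}"
    by (simp only: image_insert image_empty u) blast
  have C: "E a b" "E b c" "E c d" "E d e" "E e a" "\<not> E a c" "\<not> E b d" "\<not> E c e" "\<not> E d a" "\<not> E e b"
    using C5 by (simp_all add: induced_C5_def)
  have C': "E b a" "E c b" "E d c" "E e d" "E a e" "\<not> E c a" "\<not> E d b" "\<not> E e c" "\<not> E a d" "\<not> E b e"
    using C sym by blast+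
  have none: "\<not> E s a \<and> \<not> E s b \<and> \<not> E s c \<and> \<not> E s d \<and> \<not> E s e"
    if "s \<notin> K" "s \<notin> {a, b, c, d, e}" for s
    using induced_C5_all_or_none[OF C5 that(2)] that unfolding K_def by blast
  show thesis
  proof (rule that[of K u])
    show "clique E K"
      unfolding clique_def
    proof (intro ballI impI, rule ccontr)
      \<comment> \<open>Two non-adjacent vertices of \<open>K\<close> would form a four-cycle with
        the non-adjacent pair \<open>a\<close>, \<open>c\<close>.\<close>
      fix x y assume xy: "x \<in> K" "y \<in> K" "x \<noteq> y" "\<not> E x y"
      then have "E x a" "E a y" "E y c" "E c x" using sym by (auto simp: K_def)
      moreover have "a \<noteq> c" using C C' by blast
      ultimately show False using no_C4[of x a y c] xy C by blast
    qed
    show "independent_set E (- (K \<union> u ` {..<5}))"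
      unfolding independent_set_def
    proof (intro ballI notI)
      \<comment> \<open>Such an edge would form a 2K_2 with the pentagon edge
        \<open>a b\<close>.\<close>
      fix x y assume "x \<in> - (K \<union> u ` {..<5})" "y \<in> - (K \<union> u ` {..<5})" "E x y"
      then show False
        using no_2K2[of x y a b] none[of x] none[of y] C(1) unfolding U by blast
    qed
    show "\<forall>i<5. u i \<notin> K" unfolding all_less_5 u K_def by simp
    show "\<forall>k\<in>K. \<forall>i<5. E k (u i)" unfolding all_less_5 u K_def by simp
    show "\<forall>s. s \<notin> K \<longrightarrow> s \<notin> u ` {..<5} \<longrightarrow> (\<forall>i<5. \<not> E s (u i))"
      unfolding all_less_5 u U using none by blast
    show "\<forall>i<5. \<forall>j<5. E (u i) (u j) \<longleftrightarrow> i \<noteq> j \<and> j \<noteq> Suc i mod 5 \<and> i \<noteq> Suc j mod 5"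
      unfolding all_less_5 u using C C' irrefl by simp
  qed
qed

text \<open>Covers missing a clique vertex are treated as for split graphs. Those containing
  \<open>K\<close> lie within \<open>K\<close> and the pentagon, and meet the pentagon in a minimal
  cover of it. The set \<open>F i\<close> omits the non-adjacent pair with indices \<open>i\<close>
  and \<open>i - 1\<close> modulo 5.\<close>

lemma (in C4_2K2_free) minimal_covers_pseudo_split:
  assumes K: "clique E K" and S: "independent_set E (- (K \<union> u ` {..<5}))"
    and uK: "\<forall>i<5. u i \<notin> K" and all: "\<forall>k\<in>K. \<forall>i<5. E k (u i)"
    and none: "\<forall>s. s \<notin> K \<longrightarrow> s \<notin> u ` {..<5} \<longrightarrow> (\<forall>i<5. \<not> E s (u i))"
    and C5: "\<forall>i<5. \<forall>j<5. E (u i) (u j) \<longleftrightarrow> i \<noteq> j \<and> j \<noteq> Suc i mod 5 \<and> i \<noteq> Suc j mod 5"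
  defines "F \<equiv> \<lambda>i. K \<union> u ` {j. j < 5 \<and> i \<noteq> j \<and> i \<noteq> Suc j mod 5}"
  shows "\<And>i j. i < 5 \<Longrightarrow> j < 5 \<Longrightarrow> u j \<in> F i \<longleftrightarrow> i \<noteq> j \<and> i \<noteq> Suc j mod 5"
    and "{C. minimal_cover E C} = case_sum (\<lambda>k. {v. E k v}) F ` (K <+> {..<5})"
proof -
  \<comment> \<open>Distinct vertices of a pentagon have distinct neighbourhoods on it.\<close>
  have inj: "i = j" if "i < 5" "j < 5" "u i = u j" for i j
  proof (rule ccontr)
    assume "i \<noteq> j"
    have False if "\<forall>l<5. E (u i) (u l) \<longleftrightarrow> E (u j) (u l)"
    proof -
      have *: "\<forall>l<5. (i \<noteq> l \<and> l \<noteq> Suc i mod 5 \<and> i \<noteq> Suc l mod 5) \<longleftrightarrow>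
          (j \<noteq> l \<and> l \<noteq> Suc j mod 5 \<and> j \<noteq> Suc l mod 5)"
        using that C5 \<open>i < 5\<close> \<open>j < 5\<close> by simp
      have "\<forall>i<5::nat. \<forall>j<5::nat. (\<forall>l<5. (i \<noteq> l \<and> l \<noteq> Suc i mod 5 \<and> i \<noteq> Suc l mod 5) \<longleftrightarrow>
          (j \<noteq> l \<and> l \<noteq> Suc j mod 5 \<and> j \<noteq> Suc l mod 5)) \<longrightarrow> i = j"
        unfolding all_less_5 by simp
      then show False using * \<open>i \<noteq> j\<close> \<open>i < 5\<close> \<open>j < 5\<close> by blast
    qed
    then show False using \<open>u i = u j\<close> by simp
  qed
  show mem_F: "u j \<in> F i \<longleftrightarrow> i \<noteq> j \<and> i \<noteq> Suc j mod 5" if "i < 5" "j < 5" for i j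
    using that uK inj unfolding F_def by blast
  have cov_Inr: "minimal_cover E (F i)" if i: "i < 5" for i
    unfolding minimal_cover_def
  proof (intro conjI allI impI ballI)
    fix x y assume "E x y"
    show "x \<in> F i \<or> y \<in> F i"
    proof (rule ccontr)
      assume xy: "\<not> (x \<in> F i \<or> y \<in> F i)"
      then have "x \<notin> K" "y \<notin> K" by (auto simp: F_def)
      then have "x \<in> u ` {..<5} \<and> y \<in> u ` {..<5}"
        using S none \<open>E x y\<close> sym unfolding independent_set_def by blast
      then obtain p q where pq: "p < 5" "q < 5" "x = u p" "y = u q" by blast
      then have "(i = p \<or> i = Suc p mod 5) \<and> (i = q \<or> i = Suc q mod 5)"
        using xy mem_F i by blast
      moreover have "p \<noteq> q \<and> q \<noteq> Suc p mod 5 \<and> p \<noteq> Suc q mod 5"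
        using C5 pq \<open>E x y\<close> by blast
      moreover have "\<forall>p<5::nat. \<forall>q<5::nat. Suc p mod 5 = Suc q mod 5 \<longrightarrow> p = q"
        unfolding all_less_5 by simp
      ultimately show False using pq(1,2) by metis
    qed
  next
    fix c assume "c \<in> F i"
    then consider "c \<in> K" | j where "j < 5" "c = u j" "i \<noteq> j" "i \<noteq> Suc j mod 5"
      by (auto simp: F_def)
    then show "\<exists>x. x \<notin> F i \<and> E c x"
    proof cases
      case 1
      then show ?thesis using all mem_F i by blast
    next
      case 2
      \<comment> \<open>The omitted vertices are \<open>i\<close> and \<open>(i + 4) mod 5\<close>,
        the cyclic predecessor; every other pentagon vertex is adjacent to one of them.\<close>
      have "\<forall>i<5::nat. \<forall>j<5::nat. i \<noteq> j \<longrightarrow> i \<noteq> Suc j mod 5 \<longrightarrow>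
          (\<exists>l\<in>{i, (i + 4) mod 5}. (i = l \<or> i = Suc l mod 5) \<and>
            j \<noteq> l \<and> l \<noteq> Suc j mod 5 \<and> j \<noteq> Suc l mod 5)"
        unfolding all_less_5 by simp
      then obtain l where l: "l \<in> {i, (i + 4) mod 5}" "i = l \<or> i = Suc l mod 5"
          "j \<noteq> l \<and> l \<noteq> Suc j mod 5 \<and> j \<noteq> Suc l mod 5"
        using i 2 by blast
      moreover have "l < 5" using l(1) i by auto
      ultimately have "u l \<notin> F i \<and> E c (u l)"
        using mem_F i C5 2 by blast
      then show ?thesis by blast
    qed
  qed
  have cov_Inl: "minimal_cover E {v. E k v}" if k: "k \<in> K" for k
  proof -
    have K_k: "x = k" if "x \<in> K \<union> u ` {..<5}" "\<not> E k x" for x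
      using K all k that unfolding clique_def by (metis UnE imageE lessThan_iff)
    have "E k x \<or> E k y" if E: "E x y" for x y
    proof (cases "x \<in> K \<union> u ` {..<5} \<or> y \<in> K \<union> u ` {..<5}")
      case True
      then show ?thesis
        using K_k[of x] K_k[of y] E sym[of x y] by blast
    next
      case False
      then show ?thesis using S E unfolding independent_set_def by blast
    qed
    moreover have "E c k" if "E k c" for c using that sym[of c k] by simp
    ultimately show ?thesis using irrefl[of k] unfolding minimal_cover_def by blast
  qed
  show "{C. minimal_cover E C} = case_sum (\<lambda>k. {v. E k v}) F ` (K <+> {..<5})"
  proof (intro equalityI subsetI)
    fix C assume "C \<in> {C. minimal_cover E C}"
    then have C: "\<And>x y. E x y \<Longrightarrow> x \<in> C \<or> y \<in> C" "\<And>c. c \<in> C \<Longrightarrow> \<exists>x. x \<notin> C \<and> E c x"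
      by (auto simp: minimal_cover_def)
    show "C \<in> case_sum (\<lambda>k. {v. E k v}) F ` (K <+> {..<5})"
    proof (cases "K \<subseteq> C")
      case True
      \<comment> \<open>A vertex elsewhere has neighbours only in \<open>K\<close>, which is already
        in \<open>C\<close>.\<close>
      have "C \<subseteq> K \<union> u ` {..<5}"
        using C(2) S none True sym unfolding independent_set_def by blast
      have "\<forall>i<5. u i \<in> C \<or> u ((i + 2) mod 5) \<in> C"
      proof (intro allI impI)
        fix i :: nat assume i: "i < 5"
        have "\<forall>i<5::nat. (i + 2) mod 5 < 5 \<and> i \<noteq> (i + 2) mod 5 \<and> (i + 2) mod 5 \<noteq> Suc i mod 5 \<and>
            i \<noteq> Suc ((i + 2) mod 5) mod 5"
          unfolding all_less_5 by simp
        then have "E (u i) (u ((i + 2) mod 5))" using C5 i by blast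
        then show "u i \<in> C \<or> u ((i + 2) mod 5) \<in> C" by (rule C(1))
      qed
      then have cov: "u 0 \<in> C \<or> u 2 \<in> C" "u 1 \<in> C \<or> u 3 \<in> C" "u 2 \<in> C \<or> u 4 \<in> C"
          "u 3 \<in> C \<or> u 0 \<in> C" "u 4 \<in> C \<or> u 1 \<in> C"
        unfolding all_less_5 by (simp_all add: numeral_2_eq_2)
      \<comment> \<open>The pentagon neighbours of \<open>u i\<close> have indices
        \<open>i + 2\<close> and \<open>i + 3\<close>. If both lay in \<open>C\<close>, minimality
        would fail at \<open>u i\<close>, whose remaining neighbours are in
        \<open>K\<close>.\<close>
      have "\<forall>i<5. \<not> (u i \<in> C \<and> u ((i + 2) mod 5) \<in> C \<and> u ((i + 3) mod 5) \<in> C)"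
      proof (intro allI impI notI)
        fix i :: nat assume i: "i < 5" "u i \<in> C \<and> u ((i + 2) mod 5) \<in> C \<and> u ((i + 3) mod 5) \<in> C"
        then obtain x where x: "x \<notin> C" "E (u i) x" using C(2) by blast
        then have "x \<in> u ` {..<5}" using none True i sym by blast
        then obtain j where j: "j < 5" "x = u j" by blast
        have "\<forall>i<5::nat. \<forall>j<5. i \<noteq> j \<and> j \<noteq> Suc i mod 5 \<and> i \<noteq> Suc j mod 5 \<longrightarrow>
            j = (i + 2) mod 5 \<or> j = (i + 3) mod 5"
          unfolding all_less_5 by simp
        then have "j = (i + 2) mod 5 \<or> j = (i + 3) mod 5"
          using C5 x(2) i(1) j by blast
        then show False using i(2) x(1) j(2) by blast
      qed
      then have priv: "\<not> (u 0 \<in> C \<and> u 2 \<in> C \<and> u 3 \<in> C)" "\<not> (u 1 \<in> C \<and> u 3 \<in> C \<and> u 4 \<in> C)"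
          "\<not> (u 2 \<in> C \<and> u 4 \<in> C \<and> u 0 \<in> C)" "\<not> (u 3 \<in> C \<and> u 0 \<in> C \<and> u 1 \<in> C)"
          "\<not> (u 4 \<in> C \<and> u 1 \<in> C \<and> u 2 \<in> C)"
        unfolding all_less_5 by (simp_all add: numeral_2_eq_2)
      \<comment> \<open>The five cases are \<open>F 0\<close> to \<open>F 4\<close> in this
        order.\<close>
      have "(u 0 \<notin> C \<and> u 1 \<in> C \<and> u 2 \<in> C \<and> u 3 \<in> C \<and> u 4 \<notin> C) \<or>
          (u 0 \<notin> C \<and> u 1 \<notin> C \<and> u 2 \<in> C \<and> u 3 \<in> C \<and> u 4 \<in> C) \<or>
          (u 0 \<in> C \<and> u 1 \<notin> C \<and> u 2 \<notin> C \<and> u 3 \<in> C \<and> u 4 \<in> C) \<or>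
          (u 0 \<in> C \<and> u 1 \<in> C \<and> u 2 \<notin> C \<and> u 3 \<notin> C \<and> u 4 \<in> C) \<or>
          (u 0 \<in> C \<and> u 1 \<in> C \<and> u 2 \<in> C \<and> u 3 \<notin> C \<and> u 4 \<notin> C)"
        using cov priv by argo
      then have "\<exists>i<5. \<forall>j<5. u j \<in> C \<longleftrightarrow> i \<noteq> j \<and> i \<noteq> Suc j mod 5"
      proof (elim disjE)
        assume "u 0 \<notin> C \<and> u 1 \<in> C \<and> u 2 \<in> C \<and> u 3 \<in> C \<and> u 4 \<notin> C"
        then have "\<forall>j<5. u j \<in> C \<longleftrightarrow> 0 \<noteq> j \<and> 0 \<noteq> Suc j mod 5"
          unfolding all_less_5 by simp
        then show ?thesis by (intro exI[of _ 0]) simp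
      next
        assume "u 0 \<notin> C \<and> u 1 \<notin> C \<and> u 2 \<in> C \<and> u 3 \<in> C \<and> u 4 \<in> C"
        then have "\<forall>j<5. u j \<in> C \<longleftrightarrow> 1 \<noteq> j \<and> 1 \<noteq> Suc j mod 5"
          unfolding all_less_5 by simp
        then show ?thesis by (intro exI[of _ 1]) simp
      next
        assume "u 0 \<in> C \<and> u 1 \<notin> C \<and> u 2 \<notin> C \<and> u 3 \<in> C \<and> u 4 \<in> C"
        then have "\<forall>j<5. u j \<in> C \<longleftrightarrow> 2 \<noteq> j \<and> 2 \<noteq> Suc j mod 5"
          unfolding all_less_5 by simp
        then show ?thesis by (intro exI[of _ 2]) simp
      next
        assume "u 0 \<in> C \<and> u 1 \<in> C \<and> u 2 \<notin> C \<and> u 3 \<notin> C \<and> u 4 \<in> C"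
        then have "\<forall>j<5. u j \<in> C \<longleftrightarrow> 3 \<noteq> j \<and> 3 \<noteq> Suc j mod 5"
          unfolding all_less_5 by simp
        then show ?thesis by (intro exI[of _ 3]) simp
      next
        assume "u 0 \<in> C \<and> u 1 \<in> C \<and> u 2 \<in> C \<and> u 3 \<notin> C \<and> u 4 \<notin> C"
        then have "\<forall>j<5. u j \<in> C \<longleftrightarrow> 4 \<noteq> j \<and> 4 \<noteq> Suc j mod 5"
          unfolding all_less_5 by simp
        then show ?thesis by (intro exI[of _ 4]) simp
      qed
      then obtain i where i: "i < 5" "\<forall>j<5. u j \<in> C \<longleftrightarrow> i \<noteq> j \<and> i \<noteq> Suc j mod 5"
        by blast
      then have "C = F i"
        using \<open>C \<subseteq> K \<union> u ` {..<5}\<close> True unfolding F_def by blast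
      then show ?thesis using i(1) by force
    next
      case False
      then obtain k where k: "k \<in> K" "k \<notin> C" by blast
      have "C = {v. E k v}"
      proof (intro equalityI subsetI CollectI)
        fix c assume "c \<in> C"
        then obtain x where x: "x \<notin> C" "E c x" using C(2) by blast
        show "E k c"
        proof (cases "c \<in> K \<union> u ` {..<5}")
          case True
          then show ?thesis using K all k True \<open>c \<in> C\<close> unfolding clique_def by (metis UnE imageE lessThan_iff)
        next
          case False
          then have "x \<in> K" using S none x unfolding independent_set_def by blast
          then have "x = k" using K C(1) x k unfolding clique_def by blast
          then show ?thesis using x sym by blast
        qed
      qed (use C(1) k in blast)
      then show ?thesis using k by force
    qed
  next
    fix C assume "C \<in> case_sum (\<lambda>k. {v. E k v}) F ` (K <+> {..<5})"
    then show "C \<in> {C. minimal_cover E C}"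
      using cov_Inl cov_Inr by auto
  qed
qed

theorem theorem3p7:
  fixes G :: "'v::finite graph" and s :: nat
  assumes "simple_graph G" and "verts G = UNIV"
    and "induced_free C4 G" and "induced_free two_K2 G"
    and "edges G \<noteq> {}"
    and "s \<ge> 1"
  shows "linear_quotients
    (ideal_power (vertex_cover_ideal G :: ('v, 'k::field) mpoly set) s)"
proof -
  let ?E = "adj G"
  interpret C4_2K2_free ?E
  proof
    show "?E x y \<longleftrightarrow> ?E y x" for x y by (rule adj_sym)
    show "\<not> ?E x x" for x by (rule adj_irrefl[OF assms(1)])
  qed (fact induced_free_C4D[OF assms(1,2,3)], fact induced_free_two_K2D[OF assms(1,2,4)])
  show ?thesis
  \<comment> \<open>Without a pentagon the graph is split and has only one minimal cover containing
    \<open>K\<close>; otherwise there are five.\<close>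
  proof (cases "\<exists>a b c d e. induced_C5 ?E a b c d e")
    case False
    then obtain K where K: "clique ?E K" "independent_set ?E (- K)" "\<And>k. k \<in> K \<Longrightarrow> \<exists>v. v \<notin> K \<and> ?E k v"
      using ex_split_partition by blast
    let ?cov = "case_sum (\<lambda>k. {v. ?E k v}) (\<lambda>_::nat. K)"
    have clq: "?E k k' \<longleftrightarrow> k' \<noteq> k" if "k \<in> K" "k' \<in> K" for k k'
      using K(1) that irrefl unfolding clique_def by metis
    have "linear_quotients (ideal_power
        (ideal_gen ((\<lambda>j. \<Prod>v\<in>?cov j. var v) ` (K <+> {0})) :: ('v, 'k) mpoly set) s)"
    proof (rule linear_quotients_split)
      show "k' \<in> ?cov (Inl k) \<longleftrightarrow> k' \<noteq> k" if "k \<in> K" "k' \<in> K" for k k'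
        using clq that by simp
      show "?cov (Inr 0) \<subseteq> insert k (?cov (Inl k))" if "k \<in> K" for k
        using clq that by auto
      show "\<exists>v. v \<in> ?cov (Inl k) \<and> v \<notin> ?cov (Inr 0)" if "k \<in> K" for k
        using K(3)[OF that] by auto
    qed simp
    then show ?thesis
      by (simp only: vertex_cover_ideal_eq[OF assms(1,2) minimal_covers_split[OF K]])
  next
    case True
    then obtain a b c d e where C5: "induced_C5 ?E a b c d e" by blast
    obtain K u where K: "clique ?E K" "independent_set ?E (- (K \<union> u ` {..<5::nat}))"
        "\<forall>i<5. u i \<notin> K" "\<forall>k\<in>K. \<forall>i<5. ?E k (u i)"
        "\<forall>s. s \<notin> K \<longrightarrow> s \<notin> u ` {..<5} \<longrightarrow> (\<forall>i<5. \<not> ?E s (u i))"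
        "\<forall>i<5. \<forall>j<5. ?E (u i) (u j) \<longleftrightarrow> i \<noteq> j \<and> j \<noteq> Suc i mod 5 \<and> i \<noteq> Suc j mod 5"
      using ex_pseudo_split_partition[OF C5] by blast
    define F where "F i = K \<union> u ` {j. j < 5 \<and> i \<noteq> j \<and> i \<noteq> Suc j mod 5}" for i
    note covers = minimal_covers_pseudo_split[OF K, folded F_def]
    let ?cov = "case_sum (\<lambda>k. {v. ?E k v}) F"
    have clq: "?E k k' \<longleftrightarrow> k' \<noteq> k" if "k \<in> K" "k' \<in> K" for k k'
      using K(1) that irrefl unfolding clique_def by metis
    have "linear_quotients (ideal_power
        (ideal_gen ((\<lambda>j. \<Prod>v\<in>?cov j. var v) ` (K <+> {..<5})) :: ('v, 'k) mpoly set) s)"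
    proof (rule linear_quotients_pseudo_split)
      show "k' \<in> ?cov (Inl k) \<longleftrightarrow> k' \<noteq> k" if "k \<in> K" "k' \<in> K" for k k'
        using clq that by simp
      show "k \<in> ?cov (Inr i)" if "k \<in> K" for k i
        using that by (simp add: F_def)
      \<comment> \<open>Both the pentagon and the rest of the clique consist of neighbours of
        \<open>k\<close>.\<close>
      show "?cov (Inr 0) \<subseteq> insert k (?cov (Inl k))" if "k \<in> K" for k
        using clq K(4) that by (auto simp: F_def)
      show "u i \<in> ?cov (Inl k)" if "k \<in> K" "i < 5" for k i
        using K(4) that by simp
      show "u j \<in> ?cov (Inr i) \<longleftrightarrow> i \<noteq> j \<and> i \<noteq> Suc j mod 5" if "i < 5" "j < 5" for i j
        using covers(1) that by simp
      show "v \<in> ?cov (Inr i) \<longleftrightarrow> v \<in> ?cov (Inr 0)" if "v \<notin> u ` {..<5}" "i < 5" for v i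
        using that by (auto simp: F_def)
    qed
    then show ?thesis
      by (simp only: vertex_cover_ideal_eq[OF assms(1,2) covers(2)])
  qed
qed

end
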